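(* Let $\{S_t\}_{t\ge0}$ be a Markov Lévy walk (MLW) in $\mathbb R^d$, $d\ge1$, with skeleton Markov random walk (MRW) $\{Z_n\}_{n\ge0}$ and internal Markov chain $C$ on a countable set $\mathcal S$. Assume that $C$ is irreducible and recurrent. Then, for any $c\in\mathcal S$ and any Borel set $A\subset\mathbb R^d$, $$\mathbb P_c\Big(\bigcap_{t\ge0}\bigcup_{u\ge t}\{S_u\in A\}\Big)\in\{0,1\}\quad\text{and}\quad\mathbb P_c\Big(\bigcap_{n\ge0}\bigcup_{k\ge n}\{Z_k\in A\}\Big)\in\{0,1\}.$$ In particular, the MLW (resp. the MRW) is either recurrent or transient, in the sense that either for any $c\in\mathcal S$, $$\mathbb P_c\Big(\lim_{t\to\infty}\|S_t\|=\infty\Big)=1\quad\Big(\text{resp. }\mathbb P_c\Big(\lim_{n\to\infty}\|Z_n\|=\infty\Big)=1\Big)\qquad\text{(transience)},$$ or for any $c\in\mathcal S$ there exists $r>0$ (a priori depending on $c$) such that $$\mathbb P_c\Big(\liminf_{t\to\infty}\|S_t\|<r\Big)=1\quad\Big(\text{resp. }\mathbb P_c\Big(\liminf_{n\to\infty}\|Z_n\|<r\Big)=1\Big)\qquad\text{(recurrence)}.$$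
   Context: Let $C=\{C_n\}_{n\ge0}$ be a Markov chain on a countable discrete set $\mathcal S$ with kernel $P$. For each $c,s\in\mathcal S$ let $\{(\tau_n(c,s),\overrightarrow{\tau_n}(c,s))\}_{n\ge1}$ be an i.i.d. sequence in $[0,\infty)\times\mathbb R^d$ with common law $m_{c,s}$, these sequences being independent of each other and of $C$. Assume $m_{c,s}(\{0\}\times(\mathbb R^d\setminus\{0\}))=0$ whenever $P(c,s)>0$. Set $B_0=0$, $B_n=\sum_{k=1}^n\tau_k(C_{k-1},C_k)$, $N(t)=\max\{n\ge0:B_n\le t\}$ (assumed to be well defined, i.e. finite, almost surely). The Markov Lévy walk is the continuous linear interpolation $$S_t=\sum_{n=1}^{N(t)}\overrightarrow{\tau_n}(C_{n-1},C_n)+\frac{t-B_{N(t)}}{\tau_{N(t)+1}(C_{N(t)},C_{N(t)+1})}\,\overrightarrow{\tau_{N(t)+1}}(C_{N(t)},C_{N(t)+1}),$$ and its skeleton Markov random walk is $Z_0=0$, $Z_n=S_{B_n}=\sum_{k=1}^n\overrightarrow{\tau_k}(C_{k-1},C_k)$. $\mathbb P_c$ denotes the law when $C_0=c$ and $S_0=Z_0=0$. *)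

theory Defs
  imports "HOL-Probability.Probability"
begin

section \<open>Markov chains on a countable state space\<close>

primrec kernel_power :: "('s \<Rightarrow> 's pmf) \<Rightarrow> nat \<Rightarrow> 's \<Rightarrow> 's pmf" where
  "kernel_power K 0 c = return_pmf c"
| "kernel_power K (Suc n) c = bind_pmf (kernel_power K n c) K"

definition irreducible_kernel :: "('s \<Rightarrow> 's pmf) \<Rightarrow> bool" where
  "irreducible_kernel K \<longleftrightarrow> (\<forall>c s. \<exists>n. pmf (kernel_power K n c) s > 0)"

definition markov_chain ::
    "('s::countable \<Rightarrow> 's pmf) \<Rightarrow> 's \<Rightarrow> 'w measure \<Rightarrow> (nat \<Rightarrow> 'w \<Rightarrow> 's) \<Rightarrow> bool" where
  "markov_chain K c M C \<longleftrightarrow>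
     (\<forall>n. C n \<in> measurable M (count_space UNIV)) \<and>
     (AE \<omega> in M. C 0 \<omega> = c) \<and>
     (\<forall>n x y. \<P>(\<omega> in M. \<forall>k\<le>n. C k \<omega> = x k) > 0 \<longrightarrow>
        \<P>(\<omega> in M. C (Suc n) \<omega> = y \<bar> \<forall>k\<le>n. C k \<omega> = x k) = pmf (K (x n)) y)"

definition recurrent_chain :: "('s \<Rightarrow> 'w measure) \<Rightarrow> (nat \<Rightarrow> 'w \<Rightarrow> 's) \<Rightarrow> bool" where
  "recurrent_chain Pr C \<longleftrightarrow> (\<forall>c. AE \<omega> in Pr c. \<exists>n\<ge>1. C n \<omega> = c)"


section \<open>The Markov random walk and the Markov Levy walk\<close>

text \<open>
  \<open>X a b n\<close> is the pair of the duration and the displacement attached to the \<open>n\<close>-th passage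
  variable (\<open>n \<ge> 1\<close>) of the transition from \<open>a\<close> to \<open>b\<close>.  The value \<open>X a b 0\<close> is never used.
\<close>

definition step ::
    "(nat \<Rightarrow> 'w \<Rightarrow> 's) \<Rightarrow> ('s \<Rightarrow> 's \<Rightarrow> nat \<Rightarrow> 'w \<Rightarrow> real \<times> 'a) \<Rightarrow> nat \<Rightarrow> 'w \<Rightarrow> real \<times> 'a" where
  "step C X k \<omega> = X (C (k - 1) \<omega>) (C k \<omega>) k \<omega>"

definition renewal_time ::
    "(nat \<Rightarrow> 'w \<Rightarrow> 's) \<Rightarrow> ('s \<Rightarrow> 's \<Rightarrow> nat \<Rightarrow> 'w \<Rightarrow> real \<times> 'a) \<Rightarrow> nat \<Rightarrow> 'w \<Rightarrow> real" where
  "renewal_time C X n \<omega> = (\<Sum>k=1..n. fst (step C X k \<omega>))"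

text \<open>
  \<open>Max\<close> is the intended maximum for \<open>t \<ge> 0\<close> whenever the set is finite, which the locale
  below requires almost surely; on the exceptional null set the value is irrelevant.
\<close>

definition renewal_count ::
    "(nat \<Rightarrow> 'w \<Rightarrow> 's) \<Rightarrow> ('s \<Rightarrow> 's \<Rightarrow> nat \<Rightarrow> 'w \<Rightarrow> real \<times> 'a) \<Rightarrow> real \<Rightarrow> 'w \<Rightarrow> nat" where
  "renewal_count C X t \<omega> = Max {n. renewal_time C X n \<omega> \<le> t}"

definition MRW ::
    "(nat \<Rightarrow> 'w \<Rightarrow> 's) \<Rightarrow> ('s \<Rightarrow> 's \<Rightarrow> nat \<Rightarrow> 'w \<Rightarrow> real \<times> 'a::euclidean_space) \<Rightarrow> nat \<Rightarrow> 'w \<Rightarrow> 'a" where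
  "MRW C X n \<omega> = (\<Sum>k=1..n. snd (step C X k \<omega>))"

definition MLW ::
    "(nat \<Rightarrow> 'w \<Rightarrow> 's) \<Rightarrow> ('s \<Rightarrow> 's \<Rightarrow> nat \<Rightarrow> 'w \<Rightarrow> real \<times> 'a::euclidean_space) \<Rightarrow> real \<Rightarrow> 'w \<Rightarrow> 'a" where
  "MLW C X t \<omega> =
     (let N = renewal_count C X t \<omega> in
        (\<Sum>n=1..N. snd (step C X n \<omega>)) +
        ((t - renewal_time C X N \<omega>) / fst (step C X (N + 1) \<omega>)) *\<^sub>R snd (step C X (N + 1) \<omega>))"

text \<open>
  \<open>Pr c\<close> is the law under which the chain starts at \<open>c\<close>.  The laws \<open>m a b\<close> are Borel probability
  measures on \<open>[0,\<infinity>) \<times> \<real>\<^sup>d\<close>, encoded as measures on \<open>\<real> \<times> \<real>\<^sup>d\<close> with almost surely nonnegative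
  first coordinate; that they are Borel probability measures follows from \<open>law\<close>.
  \<open>indep_vars\<close> requires both sides to have the same value type, so independence of the chain and
  the array is stated through the sigma-algebras they generate.
\<close>

locale markov_levy_walk =
  fixes K :: "'s::countable \<Rightarrow> 's pmf"
    and m :: "'s \<Rightarrow> 's \<Rightarrow> (real \<times> 'a::euclidean_space) measure"
    and Pr :: "'s \<Rightarrow> 'w measure"
    and C :: "nat \<Rightarrow> 'w \<Rightarrow> 's"
    and X :: "'s \<Rightarrow> 's \<Rightarrow> nat \<Rightarrow> 'w \<Rightarrow> real \<times> 'a"
  assumes prob: "prob_space (Pr c)"
    and chain: "markov_chain K c (Pr c) C"
    and law: "n \<ge> 1 \<Longrightarrow> distr (Pr c) borel (X a b n) = m a b"
    and array_indep: "prob_space.indep_vars (Pr c) (\<lambda>_. borel) (\<lambda>(a, b, n). X a b n)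
          (UNIV \<times> UNIV \<times> {1..})"
    and chain_array_indep: "prob_space.indep_set (Pr c)
          (sets (vimage_algebra (space (Pr c)) (\<lambda>\<omega> n. C n \<omega>)
            (\<Pi>\<^sub>M n\<in>UNIV. count_space UNIV)))
          (sets (vimage_algebra (space (Pr c))
            (\<lambda>\<omega>. \<lambda>(a, b, n)\<in>UNIV \<times> UNIV \<times> {1..}. X a b n \<omega>)
            (\<Pi>\<^sub>M i\<in>UNIV \<times> UNIV \<times> {1..}. borel)))"
    and duration_nonneg: "AE p in m a b. fst p \<ge> 0"
    and no_jump: "pmf (K a) b > 0 \<Longrightarrow> emeasure (m a b) ({0} \<times> (UNIV - {0})) = 0"
    and count_finite: "AE \<omega> in Pr c. \<forall>t\<ge>0. finite {n. renewal_time C X n \<omega> \<le> t}"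


section \<open>Transience and recurrence of a walk\<close>

text \<open>The time domain is \<open>real\<close> for the Levy walk and \<open>nat\<close> for the skeleton random walk.\<close>

definition transient_walk ::
    "('s \<Rightarrow> 'w measure) \<Rightarrow> ('t::linorder \<Rightarrow> 'w \<Rightarrow> 'a::euclidean_space) \<Rightarrow> bool" where
  "transient_walk Pr Y \<longleftrightarrow>
     (\<forall>c. AE \<omega> in Pr c. filterlim (\<lambda>t. norm (Y t \<omega>)) at_top at_top)"

definition recurrent_walk ::
    "('s \<Rightarrow> 'w measure) \<Rightarrow> ('t::linorder \<Rightarrow> 'w \<Rightarrow> 'a::euclidean_space) \<Rightarrow> bool" where
  "recurrent_walk Pr Y \<longleftrightarrow>
     (\<forall>c. \<exists>r>0. AE \<omega> in Pr c. Liminf at_top (\<lambda>t. ereal (norm (Y t \<omega>))) < ereal r)"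

end

theory Submission
  imports Defs
begin

text \<open>
  Cut at its successive visits of the starting state \<open>c\<close>, the skeleton walk becomes a random walk with
  i.i.d. increments, and the probability \<open>h z\<close> that it visits a set infinitely often when started from
  \<open>z\<close> is a bounded harmonic function of that random walk. By Choquet--Deny, \<open>h\<close> is constant along
  almost every trajectory, so the event is independent of every initial segment of the path, hence of
  itself. The interpolated walk visits \<open>A\<close> at arbitrarily large times iff infinitely many of the
  segments between consecutive skeleton points meet \<open>A\<close>; this is an event of the same kind for an
  analytic instead of a Borel set of segments, and a capacity argument replaces it by a Borel one up to
  a null set. Irreducibility carries divergence of the norm from one starting state to all others.
\<close>

section \<open>Analytic sets and measurable projection\<close>

text \<open>The single steps are in general neither identically distributed nor exchangeable, so the
  zero-one law for exchangeable events does not apply to them. Harmonicity also avoids constructing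
  the sequence of i.i.d. blocks: for each \<open>n\<close> the displacement accumulated up to the
  first visit of the starting state at or after time \<open>n\<close> has one law, and Choquet--Deny
  is applied to each of these laws separately. Letting \<open>n\<close> vary covers all initial
  segments. Durations enter only pathwise: they guarantee that the interpolation runs through every
  segment and that unbounded time means infinitely many segments. After that, both events speak of
  states and displacements alone. For the interpolated walk the union over real times is
  uncountable, so for a general Borel set its zero-one law is stated in the completion of the
  probability space. In the dichotomy the target sets are open balls of integer radius; the segments
  meeting such a ball form an open set, and countably many radii decide whether the norm
  diverges.\<close>

definition analytic_set :: "'a::topological_space set \<Rightarrow> bool" where
  "analytic_set A \<longleftrightarrow> (\<exists>H :: ('a \<times> (nat \<Rightarrow> nat)) set. closed H \<and> A = fst ` H)"

text \<open>The first Baire digit selects the index \<open>n\<close>; the remaining digits are a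
  witness for membership in \<open>A n\<close>.\<close>

lemma analytic_set_UN:
  fixes A :: "nat \<Rightarrow> 'a::topological_space set"
  assumes "\<And>n. analytic_set (A n)"
  shows "analytic_set (\<Union>n. A n)"
proof -
  obtain H :: "nat \<Rightarrow> ('a \<times> (nat \<Rightarrow> nat)) set"
    where H: "\<And>n. closed (H n)" "\<And>n. A n = fst ` H n"
    using assms unfolding analytic_set_def by metis
  \<comment> \<open>"The tail lies in the set chosen by digit 0" is written as an intersection over
    \<open>j\<close> of two-term unions. Each term is closed because a digit is a continuous map
    into a discrete space.\<close>
  define K where "K = (\<Inter>j. ((\<lambda>p. snd p 0) -` (- {j}) \<union> (\<lambda>p. (fst p, \<lambda>i. snd p (Suc i))) -` H j))"
  have c: "continuous_on UNIV (\<lambda>p::'a \<times> (nat \<Rightarrow> nat). snd p k)" for k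
    by (rule continuous_on_compose2[OF continuous_on_product_coordinates]) (auto intro: continuous_intros)
  have cl: "closed (- {j})" for j :: nat
    by (simp add: closed_def) (rule Topological_Spaces.open_discrete)
  have "closed K"
    unfolding K_def
    by (intro closed_INT ballI closed_Un closed_vimage H cl c continuous_on_Pair
        continuous_on_fst continuous_on_id continuous_on_coordinatewise_then_product)
  moreover have "(\<Union>n. A n) = fst ` K"
  proof (intro equalityI subsetI)
    fix y assume "y \<in> (\<Union>n. A n)"
    then obtain n \<sigma> where "(y, \<sigma>) \<in> H n"
      unfolding H by auto
    then have "(y, case_nat n \<sigma>) \<in> K"
      by (auto simp: K_def)
    then show "y \<in> fst ` K"
      by force
  next
    fix y assume "y \<in> fst ` K"
    then obtain \<sigma> where "(y, \<sigma>) \<in> K"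
      by auto
    then have "(y, \<lambda>i. \<sigma> (Suc i)) \<in> H (\<sigma> 0)"
      by (auto simp: K_def)
    then show "y \<in> (\<Union>n. A n)"
      unfolding H by force
  qed
  ultimately show ?thesis
    unfolding analytic_set_def by blast
qed

text \<open>One Baire sequence carries countably many witnesses: its subsequence at the positions
  \<open>prod_encode (j, i)\<close> is the witness for \<open>A j\<close>.\<close>

lemma analytic_set_INT:
  fixes A :: "nat \<Rightarrow> 'a::topological_space set"
  assumes "\<And>n. analytic_set (A n)"
  shows "analytic_set (\<Inter>n. A n)"
proof -
  obtain H :: "nat \<Rightarrow> ('a \<times> (nat \<Rightarrow> nat)) set"
    where H: "\<And>n. closed (H n)" "\<And>n. A n = fst ` H n"
    using assms unfolding analytic_set_def by metis
  define K where "K = (\<Inter>j. (\<lambda>p. (fst p, \<lambda>i. snd p (prod_encode (j, i)))) -` H j)"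
  have c: "continuous_on UNIV (\<lambda>p::'a \<times> (nat \<Rightarrow> nat). snd p k)" for k
    by (rule continuous_on_compose2[OF continuous_on_product_coordinates]) (auto intro: continuous_intros)
  have "closed K"
    unfolding K_def
    by (intro closed_INT ballI closed_vimage H c continuous_on_Pair
        continuous_on_fst continuous_on_id continuous_on_coordinatewise_then_product)
  moreover have "(\<Inter>n. A n) = fst ` K"
  proof (intro equalityI subsetI)
    fix y assume "y \<in> (\<Inter>n. A n)"
    then have "\<forall>n. \<exists>\<sigma>. (y, \<sigma>) \<in> H n"
      unfolding H by fastforce
    then obtain \<sigma> where "\<And>n. (y, \<sigma> n) \<in> H n"
      by metis
    then have "(y, \<lambda>m. \<sigma> (fst (prod_decode m)) (snd (prod_decode m))) \<in> K"
      by (auto simp: K_def)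
    then show "y \<in> fst ` K"
      by force
  next
    fix y assume "y \<in> fst ` K"
    then show "y \<in> (\<Inter>n. A n)"
      unfolding H K_def by force
  qed
  ultimately show ?thesis
    unfolding analytic_set_def by blast
qed

lemma analytic_set_closed:
  assumes "closed A"
  shows "analytic_set A"
  unfolding analytic_set_def
  by (rule exI[of _ "A \<times> UNIV"]) (auto simp: assms closed_Times)

text \<open>In a metric space an open set is the union of the closed sets of points at distance at
  least \<open>1 / (n + 1)\<close> from its complement.\<close>

lemma analytic_set_open:
  fixes A :: "'a::metric_space set"
  assumes "open A"
  shows "analytic_set A"
\<comment> \<open>The whole space is split off because \<open>infdist x {}\<close> is 0.\<close>
proof (cases "A = UNIV")
  case False
  have "A = (\<Union>n. {x. inverse (real (Suc n)) \<le> infdist x (- A)})"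
  proof (intro equalityI subsetI)
    fix x assume "x \<in> A"
    then have "infdist x (- A) > 0"
      using False assms in_closed_iff_infdist_zero[of "- A" x] infdist_nonneg[of x "- A"]
      by (auto simp: open_closed order_le_less)
    then show "x \<in> (\<Union>n. {x. inverse (real (Suc n)) \<le> infdist x (- A)})"
      using reals_Archimedean[of "infdist x (- A)"] by (auto intro: less_imp_le)
  next
    fix x assume "x \<in> (\<Union>n. {x. inverse (real (Suc n)) \<le> infdist x (- A)})"
    then obtain n where n: "inverse (real (Suc n)) \<le> infdist x (- A)"
      by auto
    have "x \<notin> - A"
    proof
      assume "x \<in> - A"
      then have "infdist x (- A) = 0"
        by simp
      moreover have "inverse (real (Suc n)) > 0"
        by simp
      ultimately show False
        using n by linarith
    qed
    then show "x \<in> A"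
      by simp
  qed
  moreover have "closed {x. inverse (real (Suc n)) \<le> infdist x (- A)}" for n
    by (intro closed_Collect_le continuous_intros)
  ultimately show ?thesis
    using analytic_set_UN[of "\<lambda>n. {x. inverse (real (Suc n)) \<le> infdist x (- A)}"]
    by (simp add: analytic_set_closed)
qed (simp add: analytic_set_closed)

lemma analytic_set_borel:
  fixes A :: "'a::metric_space set"
  assumes "A \<in> sets borel"
  shows "analytic_set A"
proof -
  have "A \<in> sigma_sets UNIV (Collect closed)"
    using assms by (simp add: borel_eq_closed)
  \<comment> \<open>Analyticity does not pass to complements, so the induction carries a set
    together with its complement.\<close>
  then have "analytic_set A \<and> analytic_set (- A)"
  proof induction
    case (Basic a)
    then show ?case
      by (auto intro: analytic_set_closed analytic_set_open open_Compl)
  next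
    case Empty
    then show ?case
      by (simp add: analytic_set_closed)
  next
    case (Compl a)
    then show ?case
      by (simp add: Compl_eq_Diff_UNIV double_diff)
  next
    case (Union a)
    then show ?case
      by (simp add: analytic_set_UN analytic_set_INT)
  qed
  then show ?thesis ..
qed

text \<open>
  Choquet's capacitability argument: the bounds \<open>M i\<close> on the Baire coordinate are chosen one by
  one, losing no outer measure beyond the prescribed threshold, and the resulting compact piece has
  a projection that is approximated from outside by closures.
\<close>

lemma closed_subset_of_projection:
  fixes H :: "('p::metric_space \<times> 'y::metric_space \<times> (nat \<Rightarrow> nat)) set"
  assumes "finite_measure \<mu>" and \<mu>: "sets \<mu> = sets borel"
    and H: "closed H" and D: "compact D"
    and G: "G = {p. \<exists>s\<in>D. \<exists>\<sigma>. (p, s, \<sigma>) \<in> H}"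
    and a: "a < outer_measure_of \<mu> G"
  shows "\<exists>F. closed F \<and> F \<subseteq> G \<and> a \<le> emeasure \<mu> F"
proof -
  interpret finite_measure \<mu> by fact
  have sp: "space \<mu> = UNIV"
    using sets_eq_imp_space_eq[OF \<mu>] by simp
  \<comment> \<open>Only the first \<open>n\<close> Baire coordinates are bounded, so
    \<open>P 0\<close> is all of \<open>G\<close>.\<close>
  define P where "P n M = {p. \<exists>s\<in>D. \<exists>\<sigma>. (\<forall>i<n. \<sigma> i \<le> M i) \<and> (p, s, \<sigma>) \<in> H}"
    for n and M :: "nat \<Rightarrow> nat"
  have PI: "p \<in> P n M" if "s \<in> D" "(p, s, \<sigma>) \<in> H" "\<And>i. i < n \<Longrightarrow> \<sigma> i \<le> M i" for p s \<sigma> n M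
    using that unfolding P_def by blast
  have PE: "\<exists>s \<sigma>. s \<in> D \<and> (p, s, \<sigma>) \<in> H \<and> (\<forall>i<n. \<sigma> i \<le> M i)" if "p \<in> P n M" for p n M
    using that unfolding P_def by blast
  \<comment> \<open>Outer measure is continuous along increasing sequences of arbitrary sets, so
    some finite bound on coordinate \<open>n\<close> already keeps it above
    \<open>a\<close>.\<close>
  have step: "\<exists>k. a < outer_measure_of \<mu> (P (Suc n) (M(n := k)))" if "a < outer_measure_of \<mu> (P n M)" for n M
  proof -
    have "incseq (\<lambda>k. P (Suc n) (M(n := k)))"
    proof (intro incseq_SucI subsetI)
      fix k p assume "p \<in> P (Suc n) (M(n := k))"
      from PE[OF this] obtain s \<sigma> where s: "s \<in> D" "(p, s, \<sigma>) \<in> H"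
        and \<sigma>: "\<forall>i<Suc n. \<sigma> i \<le> (M(n := k)) i"
        by (elim exE conjE)
      show "p \<in> P (Suc n) (M(n := Suc k))"
        using \<sigma> by (intro PI[OF s]) (auto split: if_splits intro: le_SucI)
    qed
    moreover have "(\<Union>k. P (Suc n) (M(n := k))) = P n M"
    proof (intro equalityI subsetI)
      fix p assume "p \<in> (\<Union>k. P (Suc n) (M(n := k)))"
      then obtain k where "p \<in> P (Suc n) (M(n := k))"
        by (elim UN_E)
      from PE[OF this] obtain s \<sigma> where s: "s \<in> D" "(p, s, \<sigma>) \<in> H"
        and \<sigma>: "\<forall>i<Suc n. \<sigma> i \<le> (M(n := k)) i"
        by (elim exE conjE)
      have "\<sigma> i \<le> M i" if "i < n" for i
        using \<sigma>[rule_format, of i] that by simp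
      then show "p \<in> P n M"
        by (rule PI[OF s])
    next
      fix p assume "p \<in> P n M"
      from PE[OF this] obtain s \<sigma> where s: "s \<in> D" "(p, s, \<sigma>) \<in> H" and \<sigma>: "\<forall>i<n. \<sigma> i \<le> M i"
        by (elim exE conjE)
      have "p \<in> P (Suc n) (M(n := \<sigma> n))"
        using \<sigma> by (intro PI[OF s]) (auto simp: less_Suc_eq)
      then show "p \<in> (\<Union>k. P (Suc n) (M(n := k)))"
        by (rule UN_I[OF UNIV_I])
    qed
    ultimately have "(SUP k. outer_measure_of \<mu> (P (Suc n) (M(n := k)))) = outer_measure_of \<mu> (P n M)"
      using SUP_outer_measure_of_incseq[of "\<lambda>k. P (Suc n) (M(n := k))" \<mu>] by (simp add: sp)
    with that show ?thesis
      by (metis less_SUP_iff)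
  qed
  have "P 0 (\<lambda>_. 0) = G"
    by (auto simp: P_def G)
  \<comment> \<open>\<open>f n\<close> holds the bounds after \<open>n\<close> choices. Choice
    \<open>n\<close> alters coordinate \<open>n\<close> only, so coordinate \<open>i\<close> is
    frozen from stage \<open>i + 1\<close> on, which makes the diagonal \<open>M\<close> below
    consistent with every stage.\<close>
  then have "\<exists>f. \<forall>n. a < outer_measure_of \<mu> (P n (f n)) \<and> (\<exists>k. f (Suc n) = (f n)(n := k))"
    using a step by (intro dependent_nat_choice) blast+
  then obtain f where f: "\<And>n. a < outer_measure_of \<mu> (P n (f n))" "\<And>n. \<exists>k. f (Suc n) = (f n)(n := k)"
    by blast
  have stable: "f (Suc i + k) i = f (Suc i) i" for i k
  proof (induction k)
    case (Suc k)
    then show ?case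
      using f(2)[of "Suc i + k"] by auto
  qed simp
  define M where "M i = f (Suc i) i" for i
  have M: "f n i = M i" if "i < n" for i n
    using stable[of i "n - Suc i"] that by (simp add: M_def)
  have P: "a < outer_measure_of \<mu> (P n M)" for n
  proof -
    have "P n (f n) = P n M"
      unfolding P_def by (simp add: M)
    then show ?thesis
      using f(1)[of n] by simp
  qed
  define F where "F = (\<Inter>n. closure (P n M))"
  have "F \<subseteq> G"
  proof
    fix p assume p: "p \<in> F"
    have "\<forall>n. \<exists>q s \<sigma>. dist q p < inverse (real (Suc n)) \<and> s \<in> D \<and> (q, s, \<sigma>) \<in> H \<and> (\<forall>i<n. \<sigma> i \<le> M i)"
    proof
      fix n
      have "p \<in> closure (P n M)"
        using p by (auto simp: F_def)
      then have "\<exists>q\<in>P n M. dist q p < inverse (real (Suc n))"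
        by (rule closure_approachable[THEN iffD1, rule_format]) simp
      then obtain q where "q \<in> P n M" "dist q p < inverse (real (Suc n))"
        by blast
      with PE[OF this(1)] show "\<exists>q s \<sigma>. dist q p < inverse (real (Suc n)) \<and> s \<in> D \<and> (q, s, \<sigma>) \<in> H \<and> (\<forall>i<n. \<sigma> i \<le> M i)"
        by (intro exI[of _ q]) simp
    qed
    then obtain q s \<sigma> where q: "\<And>n. dist (q n) p < inverse (real (Suc n))" and s: "\<And>n. s n \<in> D"
      and \<sigma>: "\<And>n i. i < n \<Longrightarrow> \<sigma> n i \<le> M i" and qH: "\<And>n. (q n, s n, \<sigma> n) \<in> H"
      by metis
    \<comment> \<open>\<open>M i\<close> bounds \<open>\<sigma> n i\<close> only for
      \<open>n > i\<close>; the maximum absorbs the finitely many earlier \<open>n\<close>, so all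
      witnesses lie in one compact box and a subsequence converges.\<close>
    define B where "B i = max (M i) (Max ((\<lambda>n. \<sigma> n i) ` {..i}))" for i
    have "\<sigma> n i \<le> B i" for n i
    proof (cases "i < n")
      case False
      then have "\<sigma> n i \<le> Max ((\<lambda>n. \<sigma> n i) ` {..i})"
        by (intro Max_ge) auto
      then show ?thesis
        by (simp add: B_def)
    qed (auto simp: B_def dest: \<sigma>)
    then have sB: "(s n, \<sigma> n) \<in> D \<times> PiE UNIV (\<lambda>i. {..B i})" for n
      using s by (auto simp: PiE_iff)
    have "compactin (product_topology (\<lambda>_. euclidean) UNIV) (PiE UNIV (\<lambda>i. {..B i}))"
      by (simp add: compactin_PiE finite_imp_compact)
    then have "compact (PiE UNIV (\<lambda>i. {..B i}))"
      by (simp add: euclidean_product_topology)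
    then have "seq_compact (D \<times> PiE UNIV (\<lambda>i. {..B i}))"
      by (intro compact_imp_seq_compact compact_Times D)
    from seq_compactE[OF this allI, OF sB] obtain l r
      where l: "l \<in> D \<times> PiE UNIV (\<lambda>i. {..B i})"
        and r: "strict_mono r" "((\<lambda>n. (s n, \<sigma> n)) \<circ> r) \<longlonglongrightarrow> l"
      by this
    obtain s' \<sigma>' where l': "l = (s', \<sigma>')"
      by (cases l)
    have s': "s' \<in> D"
      using l unfolding l' by (rule SigmaD1)
    have "q \<longlonglongrightarrow> p"
    proof (rule metric_tendsto_imp_tendsto[OF LIMSEQ_inverse_real_of_nat], rule always_eventually, rule allI)
      fix n
      show "dist (q n) p \<le> dist (inverse (real (Suc n))) 0"
        using q[of n] by simp
    qed
    then have "(q \<circ> r) \<longlonglongrightarrow> p"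
      using r(1) by (rule LIMSEQ_subseq_LIMSEQ)
    from tendsto_Pair[OF this r(2)[unfolded l']] have "(\<lambda>n. (q (r n), s (r n), \<sigma> (r n))) \<longlonglongrightarrow> (p, s', \<sigma>')"
      by (simp add: comp_def)
    then have "(p, s', \<sigma>') \<in> H"
      by (rule closed_sequentially[OF H qH])
    with s' show "p \<in> G"
      unfolding G by blast
  qed
  moreover have "a \<le> emeasure \<mu> F"
  proof -
    have m: "closure (P n M) \<in> sets \<mu>" for n
      by (simp add: \<mu>)
    have "P (Suc n) M \<subseteq> P n M" for n
      unfolding P_def by (intro subsetI CollectI) (use less_SucI in blast)
    then have "decseq (\<lambda>n. closure (P n M))"
      by (intro decseq_SucI closure_mono)
    moreover have "range (\<lambda>n. closure (P n M)) \<subseteq> sets \<mu>"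
      using m by blast
    ultimately have "(INF n. emeasure \<mu> (closure (P n M))) = emeasure \<mu> F"
      unfolding F_def by (intro INF_emeasure_decseq) (simp_all add: emeasure_eq_measure)
    moreover have "a \<le> emeasure \<mu> (closure (P n M))" for n
    proof -
      have "outer_measure_of \<mu> (P n M) \<le> outer_measure_of \<mu> (closure (P n M))"
        by (intro outer_measure_of_mono closure_subset)
      then show ?thesis
        using P[of n] m[of n] by (simp add: less_imp_le order.strict_trans2)
    qed
    ultimately show ?thesis
      using INF_greatest[of UNIV a "\<lambda>n. emeasure \<mu> (closure (P n M))"] by simp
  qed
  moreover have "closed F"
    unfolding F_def by (intro closed_INT ballI closed_closure)
  ultimately show ?thesis
    by blast
qed

text \<open>\<open>G\<close> has a measurable hull \<open>E\<close> of the same outer measure, and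
  closed subsets of \<open>G\<close> come within \<open>1 / (n + 1)\<close> of that value; their
  union differs from \<open>E\<close> by a null set.\<close>

lemma projection_null_sandwich:
  fixes H :: "('p::metric_space \<times> 'y::metric_space \<times> (nat \<Rightarrow> nat)) set"
  assumes "finite_measure \<mu>" and \<mu>: "sets \<mu> = sets borel"
    and H: "closed H" and D: "compact D"
    and G: "G = {p. \<exists>s\<in>D. \<exists>\<sigma>. (p, s, \<sigma>) \<in> H}"
  shows "\<exists>B N. B \<in> sets borel \<and> N \<in> null_sets \<mu> \<and> B \<subseteq> G \<and> G \<subseteq> B \<union> N"
proof -
  interpret finite_measure \<mu> by fact
  have sp: "space \<mu> = UNIV"
    using sets_eq_imp_space_eq[OF \<mu>] by simp
  obtain E where E: "E \<in> sets \<mu>" "G \<subseteq> E" "outer_measure_of \<mu> G = emeasure \<mu> E"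
    using outer_measure_of_attain[of G \<mu>] sp by auto
  have "\<exists>F. closed F \<and> F \<subseteq> G \<and> measure \<mu> E - inverse (real (Suc n)) \<le> measure \<mu> F" for n
  proof (cases "measure \<mu> E - inverse (real (Suc n)) \<le> 0")
    case False
    then have "ennreal (measure \<mu> E - inverse (real (Suc n))) < outer_measure_of \<mu> G"
      unfolding E(3) emeasure_eq_measure by (subst ennreal_less_iff) auto
    from closed_subset_of_projection[OF assms this] obtain F
      where "closed F" "F \<subseteq> G" "ennreal (measure \<mu> E - inverse (real (Suc n))) \<le> emeasure \<mu> F"
      by (elim exE conjE)
    then show ?thesis
      by (intro exI[of _ F]) (simp add: emeasure_eq_measure)
  next
    case True
    then show ?thesis
      by (intro exI[of _ "{}"]) simp
  qed
  then obtain F where F: "\<And>n. closed (F n)" "\<And>n. F n \<subseteq> G"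
    "\<And>n. measure \<mu> E - inverse (real (Suc n)) \<le> measure \<mu> (F n)"
    by metis
  define B where "B = (\<Union>n. F n)"
  have B: "B \<in> sets borel" "B \<subseteq> G"
    unfolding B_def using F by auto
  have "measure \<mu> E \<le> measure \<mu> B"
  proof (rule field_le_epsilon)
    fix e :: real assume "0 < e"
    then obtain n where n: "inverse (real (Suc n)) < e"
      using reals_Archimedean by blast
    have "measure \<mu> (F n) \<le> measure \<mu> B"
      using B by (intro finite_measure_mono) (auto simp: B_def \<mu>)
    then show "measure \<mu> E \<le> measure \<mu> B + e"
      using F(3)[of n] n by linarith
  qed
  then have "measure \<mu> (E - B) = 0"
    using B E finite_measure_Diff[of E B] measure_nonneg[of \<mu> "E - B"] by (auto simp: \<mu>)
  then have "E - B \<in> null_sets \<mu>"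
    using B E by (auto simp: null_sets_def emeasure_eq_measure \<mu>)
  with B E(2) show ?thesis
    by blast
qed

text \<open>
  The set of segments \<open>[z, z + v]\<close> meeting a Borel set need not be Borel; it is measurable only up
  to null sets.
\<close>

lemma segment_hits_null_sandwich:
  fixes A :: "'a::euclidean_space set" and \<mu> :: "nat \<Rightarrow> ('a \<times> 'a) measure"
  assumes \<mu>: "\<And>n. finite_measure (\<mu> n)" "\<And>n. sets (\<mu> n) = sets borel"
    and A: "A \<in> sets borel"
  shows "\<exists>B. B \<in> sets borel \<and> (\<forall>n. AE p in \<mu> n. p \<in> B \<longleftrightarrow> (\<exists>s\<in>{0..1}. fst p + s *\<^sub>R snd p \<in> A))"
proof -
  obtain H0 :: "('a \<times> (nat \<Rightarrow> nat)) set" where H0: "closed H0" "A = fst ` H0"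
    using analytic_set_borel[OF A] unfolding analytic_set_def by blast
  define G where "G = {p. \<exists>s\<in>{0..1::real}. fst p + s *\<^sub>R snd p \<in> A}"
  \<comment> \<open>Sends a segment \<open>(z, v)\<close>, a parameter \<open>s\<close> and a Baire
    point to the point \<open>z + s v\<close> with the same Baire point. Pulling \<open>H0\<close>
    back along this continuous map exhibits \<open>G\<close> as a projection along
    \<open>[0, 1]\<close> and Baire space.\<close>
  define f :: "('a \<times> 'a) \<times> real \<times> (nat \<Rightarrow> nat) \<Rightarrow> 'a \<times> (nat \<Rightarrow> nat)"
    where "f q = (fst (fst q) + fst (snd q) *\<^sub>R snd (fst q), snd (snd q))" for q
  have H: "closed (f -` H0)"
    unfolding f_def
    by (intro closed_vimage H0 continuous_on_Pair continuous_on_add continuous_on_scaleR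
        continuous_on_fst continuous_on_snd continuous_on_id)
  have "x \<in> A \<longleftrightarrow> (\<exists>\<sigma>. (x, \<sigma>) \<in> H0)" for x
    unfolding H0(2) by force
  then have G: "G = {p. \<exists>s\<in>{0..1}. \<exists>\<sigma>. (p, s, \<sigma>) \<in> f -` H0}"
    unfolding G_def by (simp add: f_def)
  have "\<exists>B N. B \<in> sets borel \<and> N \<in> null_sets (\<mu> n) \<and> B \<subseteq> G \<and> G \<subseteq> B \<union> N" for n
    using projection_null_sandwich[OF \<mu>(1) \<mu>(2) H compact_Icc G] .
  then obtain B N where BN: "\<And>n. B n \<in> sets borel" "\<And>n. N n \<in> null_sets (\<mu> n)"
    "\<And>n. B n \<subseteq> G" "\<And>n. G \<subseteq> B n \<union> N n"
    by metis
  \<comment> \<open>Every \<open>B n\<close> lies inside \<open>G\<close>, so their union is still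
    inside \<open>G\<close> and serves all the measures at once.\<close>
  have "AE p in \<mu> n. p \<in> (\<Union>n. B n) \<longleftrightarrow> p \<in> G" for n
    using AE_not_in[OF BN(2)[of n]]
  proof (rule eventually_mono)
    fix p assume "p \<notin> N n"
    then show "p \<in> (\<Union>n. B n) \<longleftrightarrow> p \<in> G"
      using UN_least[of UNIV B G] BN(3) BN(4)[of n] by auto
  qed
  moreover have "(\<Union>n. B n) \<in> sets borel"
    by (rule sets.countable_UN) (use BN(1) in auto)
  ultimately show ?thesis
    by (intro exI[of _ "\<Union>n. B n"]) (simp add: G_def)
qed

section \<open>The Choquet--Deny theorem for bounded functions\<close>

text \<open>
  Exchanging two increments and Jensen's inequality show that the energy
  \<open>g z = \<integral>(h (z + y) - h z)\<^sup>2\<close> is a subsolution, so that \<open>n g + h\<^sup>2 \<le> 1\<close> follows by induction on \<open>n\<close>.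
\<close>

lemma choquet_deny:
  fixes h :: "'a::euclidean_space \<Rightarrow> real"
  assumes "prob_space \<nu>" and \<nu>[measurable_cong]: "sets \<nu> = sets borel"
    and h[measurable]: "h \<in> borel_measurable borel" and h0: "\<And>z. 0 \<le> h z" and h1: "\<And>z. h z \<le> 1"
    and harmonic: "\<And>z. h z = (\<integral>y. h (z + y) \<partial>\<nu>)"
  shows "AE y in \<nu>. h (z + y) = h z"
proof -
  interpret prob_space \<nu> by fact
  interpret P: pair_prob_space \<nu> \<nu> by unfold_locales
  have le1: "(h a - h b)\<^sup>2 \<le> 1" for a b
    using h0[of a] h0[of b] h1[of a] h1[of b] by (intro abs_square_le_1[THEN iffD2]) (auto simp: abs_le_iff)
  have hsq: "(h a)\<^sup>2 \<le> 1" for a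
    using h0[of a] h1[of a] by (simp add: abs_square_le_1)
  have int_h [simp]: "integrable \<nu> (\<lambda>y. h (z + y))" for z
    by (rule integrable_const_bound[where B=1]) (auto simp: h0 h1)
  have int_h2 [simp]: "integrable \<nu> (\<lambda>y. (h (z + y))\<^sup>2)" for z
    by (rule integrable_const_bound[where B=1]) (auto simp: hsq)
  define g where "g z = (\<integral>y. (h (z + y) - h z)\<^sup>2 \<partial>\<nu>)" for z
  have int_g0 [simp]: "integrable \<nu> (\<lambda>y. (h (a + y) - h (b + y))\<^sup>2)" "integrable \<nu> (\<lambda>y. (h (a + y) - h b)\<^sup>2)" for a b
    by (rule integrable_const_bound[where B=1]; auto simp: le1)+
  have g_meas [measurable]: "g \<in> borel_measurable borel"
    unfolding g_def by measurable
  have g0: "0 \<le> g z" for z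
    unfolding g_def by simp
  have g1: "g z \<le> 1" for z
    unfolding g_def using le1 by (intro integral_le_const) auto
  have int_g [simp]: "integrable \<nu> (\<lambda>x. g (z + x))" for z
    by (rule integrable_const_bound[where B=1]) (auto simp: g0 g1)
  \<comment> \<open>Harmonicity makes the cross term equal to \<open>- 2 (h z)\<^sup>2\<close>: the
    second moment splits orthogonally, as for a martingale increment.\<close>
  have g_eq: "(\<integral>y. (h (z + y))\<^sup>2 \<partial>\<nu>) = g z + (h z)\<^sup>2" for z
  proof -
    have "g z = (\<integral>y. (h (z + y))\<^sup>2 - 2 * h z * h (z + y) + (h z)\<^sup>2 \<partial>\<nu>)"
      unfolding g_def by (simp add: power2_diff algebra_simps)
    also have "\<dots> = (\<integral>y. (h (z + y))\<^sup>2 \<partial>\<nu>) - 2 * h z * (\<integral>y. h (z + y) \<partial>\<nu>) + (h z)\<^sup>2"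
      by (simp add: prob_space)
    finally show ?thesis
      by (simp add: harmonic[of z, symmetric] power2_eq_square)
  qed
  have sub: "g z \<le> (\<integral>x. g (z + x) \<partial>\<nu>)" for z
  proof -
    have "g z \<le> (\<integral>y. (\<integral>x. (h (z + y + x) - h (z + x))\<^sup>2 \<partial>\<nu>) \<partial>\<nu>)"
      unfolding g_def
    proof (rule integral_mono)
      show "integrable \<nu> (\<lambda>y. \<integral>x. (h (z + y + x) - h (z + x))\<^sup>2 \<partial>\<nu>)"
        using le1 by (intro integrable_const_bound[where B=1] AE_I2)
          (auto simp: abs_le_iff intro!: integral_le_const order_trans[OF _ Bochner_Integration.integral_nonneg])
      fix y
      have "h (z + y) - h z = (\<integral>x. h (z + y + x) - h (z + x) \<partial>\<nu>)"
        by (simp add: harmonic[symmetric])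
      also have "\<dots>\<^sup>2 \<le> (\<integral>x. (h (z + y + x) - h (z + x))\<^sup>2 \<partial>\<nu>)"
      proof -
        let ?f = "\<lambda>x. h (z + y + x) - h (z + x)"
        have "0 \<le> variance ?f"
          by simp
        also have "variance ?f = expectation (\<lambda>x. (?f x)\<^sup>2) - (expectation ?f)\<^sup>2"
          by (rule variance_eq) auto
        finally show ?thesis
          by simp
      qed
      finally show "(h (z + y) - h z)\<^sup>2 \<le> (\<integral>x. (h (z + y + x) - h (z + x))\<^sup>2 \<partial>\<nu>)" .
    qed simp
    \<comment> \<open>After the exchange the inner integral is the energy at \<open>z + x\<close>,
      since \<open>z + y + x = z + x + y\<close>; this is where commutativity enters.\<close>
    also have "\<dots> = (\<integral>x. (\<integral>y. (h (z + y + x) - h (z + x))\<^sup>2 \<partial>\<nu>) \<partial>\<nu>)"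
      by (rule P.Fubini_integral[symmetric], rule P.integrable_const_bound[where B=1])
        (auto simp: le1)
    also have "\<dots> = (\<integral>x. g (z + x) \<partial>\<nu>)"
      unfolding g_def by (simp add: ac_simps)
    finally show ?thesis .
  qed
  have bound: "real n * g z + (h z)\<^sup>2 \<le> 1" for n z
  proof (induction n arbitrary: z)
    case (Suc n)
    have "real (Suc n) * g z + (h z)\<^sup>2 = real n * g z + (\<integral>y. (h (z + y))\<^sup>2 \<partial>\<nu>)"
      unfolding g_eq by (simp add: distrib_right)
    also have "\<dots> \<le> real n * (\<integral>x. g (z + x) \<partial>\<nu>) + (\<integral>y. (h (z + y))\<^sup>2 \<partial>\<nu>)"
      by (intro add_mono mult_left_mono sub) auto
    also have "\<dots> = (\<integral>x. real n * g (z + x) + (h (z + x))\<^sup>2 \<partial>\<nu>)"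
      by simp
    also have "\<dots> \<le> 1"
      using Suc by (intro integral_le_const) auto
    finally show ?case .
  qed (simp add: hsq)
  have "g z \<le> 0"
  proof (rule ccontr)
    assume "\<not> g z \<le> 0"
    then obtain n where "1 < real n * g z"
      using reals_Archimedean3[of "g z"] by (auto simp: not_le)
    with bound[of n z] show False
      using zero_le_power2[of "h z"] by linarith
  qed
  with g0[of z] have "g z = 0"
    by linarith
  then have "(\<integral>y. (h (z + y) - h z)\<^sup>2 \<partial>\<nu>) = 0"
    by (simp add: g_def)
  then have "AE y in \<nu>. (h (z + y) - h z)\<^sup>2 = 0"
    by (subst (asm) integral_nonneg_eq_0_iff_AE) auto
  then show ?thesis
    by simp
qed

section \<open>Laws of Markov additive paths\<close>

text \<open>The \<open>n\<close>-th entry of a path pairs the \<open>n\<close>-th state with the displacement that leaves it.\<close>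

abbreviation path_space :: "(nat \<Rightarrow> 's \<times> 'a::euclidean_space) measure" where
  "path_space \<equiv> PiM UNIV (\<lambda>_. count_space UNIV \<Otimes>\<^sub>M borel)"

text \<open>States are prescribed up to and including \<open>n\<close>, displacements only below
  \<open>n\<close>: the displacement in entry \<open>i\<close> depends on the states
  \<open>i\<close> and \<open>i + 1\<close>.\<close>

definition path_cylinder :: "nat \<Rightarrow> (nat \<Rightarrow> 's) \<Rightarrow> (nat \<Rightarrow> 'a set) \<Rightarrow> (nat \<Rightarrow> 's \<times> 'a) set" where
  "path_cylinder n x B = {w. (\<forall>i\<le>n. fst (w i) = x i) \<and> (\<forall>i<n. snd (w i) \<in> B i)}"

text \<open>The lower bound \<open>j\<close> on the length makes every generator see entry
  \<open>j\<close>, where paths will be cut. \<open>UNIV\<close> serves as the exhausting set and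
  \<open>{}\<close> as the value of empty intersections in the uniqueness theorem for
  measures.\<close>

definition path_cylinders :: "nat \<Rightarrow> (nat \<Rightarrow> 's \<times> 'a::euclidean_space) set set" where
  "path_cylinders j = {UNIV, {}} \<union> {path_cylinder n x B | n x B. j \<le> n \<and> range B \<subseteq> sets borel}"

definition walk :: "nat \<Rightarrow> (nat \<Rightarrow> 's \<times> 'a::euclidean_space) \<Rightarrow> 'a" where
  "walk n w = (\<Sum>k<n. snd (w k))"

text \<open>A position together with the next displacement is a segment, so one kind of event serves
  both walks: \<open>A \<times> UNIV\<close> for the skeleton, the segments meeting \<open>A\<close>
  for the interpolation. The starting point \<open>z\<close> is kept as the variable of a harmonic
  function.\<close>

definition hits_io :: "('a::euclidean_space \<times> 'a) set \<Rightarrow> 'a \<Rightarrow> (nat \<Rightarrow> 's \<times> 'a) set" where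
  "hits_io G z = {w. \<forall>m. \<exists>n\<ge>m. (z + walk n w, snd (w n)) \<in> G}"

text \<open>A visit at time \<open>n\<close> itself counts. On paths without a visit from
  \<open>n\<close> on the value is unspecified; such paths will form a null set.\<close>

definition hitting_time :: "'s \<Rightarrow> nat \<Rightarrow> (nat \<Rightarrow> 's \<times> 'a) \<Rightarrow> nat" where
  "hitting_time c n w = (LEAST j. n \<le> j \<and> fst (w j) = c)"

lemma space_path_space [simp]: "space path_space = UNIV"
  by (simp add: space_PiM space_pair_measure)

lemma measurable_path_coordinate [measurable]:
  "(\<lambda>w. fst (w i)) \<in> measurable path_space (count_space UNIV)"
  "(\<lambda>w. snd (w i)) \<in> borel_measurable path_space"
  by measurable

lemma measurable_walk [measurable]: "walk n \<in> borel_measurable path_space"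
  unfolding walk_def by measurable

lemma path_cylinder_sets [measurable]:
  assumes "\<And>i. B i \<in> sets borel"
  shows "path_cylinder n x B \<in> sets path_space"
proof -
  have [measurable]: "B i \<in> sets borel" for i
    by fact
  have "Measurable.pred path_space (\<lambda>w. (\<forall>i\<le>n. fst (w i) = x i) \<and> (\<forall>i<n. snd (w i) \<in> B i))"
    by measurable
  then show ?thesis
    by (simp add: pred_def path_cylinder_def)
qed

text \<open>Two cylinders that meet prescribe the same states on their common range, so the longer
  one, with the displacement sets intersected below the shorter length, is their
  intersection.\<close>

lemma Int_stable_path_cylinders: "Int_stable (path_cylinders j)"
proof (rule Int_stableI)
  have *: "\<exists>n'' x'' B''. path_cylinder n x B \<inter> path_cylinder n' x' B' = path_cylinder n'' x'' B'' \<and>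
      j \<le> n'' \<and> range B'' \<subseteq> sets borel"
    if ne: "path_cylinder n x B \<inter> path_cylinder n' x' B' \<noteq> {}" and le: "j \<le> n" "n \<le> n'"
      and B: "range B \<subseteq> sets borel" "range B' \<subseteq> sets borel"
    for n n' x x' and B B' :: "nat \<Rightarrow> 'b set"
  proof -
    obtain w where "w \<in> path_cylinder n x B \<inter> path_cylinder n' x' B'"
      using ne by blast
    then have x: "x i = x' i" if "i \<le> n" for i
      using that le by (auto simp: path_cylinder_def)
    let ?B = "\<lambda>i. if i < n then B i \<inter> B' i else B' i"
    have "path_cylinder n x B \<inter> path_cylinder n' x' B' = path_cylinder n' x' ?B"
      using x le by (auto simp: path_cylinder_def)
    moreover have "range ?B \<subseteq> sets borel"
      using B by auto
    ultimately show ?thesis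
      using le by (intro exI[of _ n'] exI[of _ x'] exI[of _ ?B]) auto
  qed
  fix a b :: "(nat \<Rightarrow> 'a \<times> 'b) set"
  assume a: "a \<in> path_cylinders j" and b: "b \<in> path_cylinders j"
  show "a \<inter> b \<in> path_cylinders j"
  proof (cases "a = UNIV \<or> b = UNIV \<or> a \<inter> b = {}")
    case True
    then show ?thesis
      using a b by (auto simp: path_cylinders_def)
  next
    case False
    have "\<exists>n x B. a = path_cylinder n x B \<and> j \<le> n \<and> range B \<subseteq> sets borel"
      using a False unfolding path_cylinders_def by blast
    moreover have "\<exists>n x B. b = path_cylinder n x B \<and> j \<le> n \<and> range B \<subseteq> sets borel"
      using b False unfolding path_cylinders_def by blast
    ultimately obtain n x B n' x' B' where ab: "a = path_cylinder n x B" "b = path_cylinder n' x' B'"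
      "j \<le> n" "j \<le> n'" "range B \<subseteq> sets borel" "range B' \<subseteq> sets borel"
      by (elim exE conjE)
    have "\<exists>n'' x'' B''. a \<inter> b = path_cylinder n'' x'' B'' \<and> j \<le> n'' \<and> range B'' \<subseteq> sets borel"
      using *[of n x B n' x' B'] *[of n' x' B' n x B] ab False
      by (cases "n \<le> n'") (auto simp: Int_commute)
    then show ?thesis
      unfolding path_cylinders_def by blast
  qed
qed

text \<open>As there are countably many state prefixes, an event about one coordinate is a countable
  union of cylinders; these may be taken longer than any given \<open>j\<close>.\<close>

lemma sets_path_space:
  "sets (path_space :: (nat \<Rightarrow> 's::countable \<times> 'a::euclidean_space) measure) = sigma_sets UNIV (path_cylinders j)"
proof (rule antisym)
  let ?S = "sigma UNIV (path_cylinders j :: (nat \<Rightarrow> 's \<times> 'a) set set)"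
  have cyl: "path_cylinder n x B \<in> sets ?S" if "j \<le> n" "\<And>i. B i \<in> sets borel" for n x and B :: "nat \<Rightarrow> 'a set"
  proof (rule in_measure_of)
    show "path_cylinder n x B \<in> path_cylinders j"
      using that unfolding path_cylinders_def by (intro UnI2 CollectI exI[of _ n] exI[of _ x] exI[of _ B]) auto
  qed simp
  have prefix: "\<exists>xs\<in>{xs. length xs = Suc n}. w \<in> path_cylinder n ((!) xs) B \<and> (\<forall>i\<le>n. xs ! i = fst (w i))"
    if "\<And>i. i < n \<Longrightarrow> snd (w i) \<in> B i" for n and w :: "nat \<Rightarrow> 's \<times> 'a" and B
    using that by (intro bexI[of _ "map (\<lambda>k. fst (w k)) [0..<Suc n]"]) (simp_all add: path_cylinder_def del: upt_Suc)
  have "(\<lambda>w. w i) \<in> measurable ?S (count_space UNIV \<Otimes>\<^sub>M borel)" for i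
  proof -
    define n where "n = Suc (max i j)"
    have n: "i < n" "j \<le> n"
      by (simp_all add: n_def)
    have "(\<lambda>w. fst (w i)) -` {s} \<inter> space ?S \<in> sets ?S" for s :: 's
    proof -
      let ?U = "\<Union>xs\<in>{xs. length xs = Suc n \<and> xs ! i = s}. path_cylinder n ((!) xs) (\<lambda>_. UNIV :: 'a set)"
      have "{w. fst (w i) = s} = ?U"
      proof (intro equalityI subsetI)
        fix w :: "nat \<Rightarrow> 's \<times> 'a" assume w: "w \<in> {w. fst (w i) = s}"
        obtain xs where "length xs = Suc n" "w \<in> path_cylinder n ((!) xs) (\<lambda>_. UNIV)" "\<forall>i\<le>n. xs ! i = fst (w i)"
          using prefix[of n w "\<lambda>_. UNIV"] by auto
        then show "w \<in> ?U"
          using w n by (intro UN_I[of xs]) auto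
      next
        fix w assume "w \<in> ?U"
        then show "w \<in> {w. fst (w i) = s}"
          using n by (auto simp: path_cylinder_def)
      qed
      also have "?U \<in> sets ?S"
        using n by (intro sets.countable_UN' countableI_type image_subsetI cyl) auto
      finally show ?thesis
        by (simp add: vimage_def)
    qed
    then have f: "(\<lambda>w. fst (w i)) \<in> measurable ?S (count_space UNIV)"
      by (simp add: measurable_count_space_eq2_countable)
    have "(\<lambda>w. snd (w i)) \<in> measurable ?S borel"
    proof (rule measurableI)
      fix A :: "'a set" assume A: "A \<in> sets borel"
      define B where "B k = (if k = i then A else UNIV)" for k
      have B: "B k \<in> sets borel" for k
        using A by (simp add: B_def)
      let ?U = "\<Union>xs\<in>{xs :: 's list. length xs = Suc n}. path_cylinder n ((!) xs) B"
      have "{w. snd (w i) \<in> A} = ?U"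
      proof (intro equalityI subsetI)
        fix w :: "nat \<Rightarrow> 's \<times> 'a" assume "w \<in> {w. snd (w i) \<in> A}"
        then have "snd (w k) \<in> B k" for k
          by (simp add: B_def)
        then show "w \<in> ?U"
          using prefix[of n w B] by auto
      next
        fix w assume "w \<in> ?U"
        then obtain xs where "w \<in> path_cylinder n ((!) xs) B"
          by (elim UN_E)
        then have "snd (w i) \<in> B i"
          using n by (simp add: path_cylinder_def)
        then show "w \<in> {w. snd (w i) \<in> A}"
          by (simp add: B_def)
      qed
      also have "?U \<in> sets ?S"
        using n by (intro sets.countable_UN' countableI_type image_subsetI cyl B) auto
      finally show "(\<lambda>w. snd (w i)) -` A \<inter> space ?S \<in> sets ?S"
        by (simp add: vimage_def)
    qed simp
    with f show ?thesis
      by (subst measurable_pair_iff) (simp add: comp_def)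
  qed
  then have id: "(\<lambda>w. w) \<in> measurable ?S path_space"
    by (intro measurable_PiM_single') (auto simp: space_pair_measure)
  show "sets (path_space :: (nat \<Rightarrow> 's \<times> 'a) measure) \<subseteq> sigma_sets UNIV (path_cylinders j)"
  proof
    fix A :: "(nat \<Rightarrow> 's \<times> 'a) set" assume "A \<in> sets path_space"
    from measurable_sets[OF id this] show "A \<in> sigma_sets UNIV (path_cylinders j)"
      by simp
  qed
  have "path_cylinders j \<subseteq> sets (path_space :: (nat \<Rightarrow> 's \<times> 'a) measure)"
    using sets.top[of "path_space :: (nat \<Rightarrow> 's \<times> 'a) measure"] path_cylinder_sets
    unfolding path_cylinders_def by (auto simp: image_subset_iff)
  from sets.sigma_sets_subset[OF this]
  show "sigma_sets UNIV (path_cylinders j) \<subseteq> sets (path_space :: (nat \<Rightarrow> 's \<times> 'a) measure)"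
    by simp
qed

lemma walk_comb_seq: "walk (j + k) (comb_seq j w w') = walk j w + walk k w'"
proof (induction k)
  case 0
  then show ?case
    by (simp add: walk_def comb_seq_def)
next
  case (Suc k)
  have "walk (j + Suc k) (comb_seq j w w') = walk (j + k) (comb_seq j w w') + snd (w' k)"
    by (simp add: walk_def comb_seq_def)
  with Suc show ?case
    by (simp add: walk_def)
qed

text \<open>Infinitely many hits are insensitive to the first \<open>j\<close> entries, except that
  these move the starting point. This identity turns the Markov property into harmonicity of the
  hitting probability.\<close>

lemma comb_seq_in_hits_io: "comb_seq j w w' \<in> hits_io G z \<longleftrightarrow> w' \<in> hits_io G (z + walk j w)"
proof -
  have *: "(z + walk (j + n) (comb_seq j w w'), snd (comb_seq j w w' (j + n))) =
    (z + walk j w + walk n w', snd (w' n))" for n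
    by (simp add: walk_comb_seq comb_seq_def add.assoc)
  show ?thesis
  proof
    assume L: "comb_seq j w w' \<in> hits_io G z"
    show "w' \<in> hits_io G (z + walk j w)"
      unfolding hits_io_def
    proof (intro CollectI allI)
      fix m
      obtain n where "n \<ge> j + m" "(z + walk n (comb_seq j w w'), snd (comb_seq j w w' n)) \<in> G"
        using L unfolding hits_io_def by blast
      then show "\<exists>n\<ge>m. (z + walk j w + walk n w', snd (w' n)) \<in> G"
        using *[of "n - j"] by (intro exI[of _ "n - j"]) (simp add: add.assoc)
    qed
  next
    assume R: "w' \<in> hits_io G (z + walk j w)"
    show "comb_seq j w w' \<in> hits_io G z"
      unfolding hits_io_def
    proof (intro CollectI allI)
      fix m
      obtain n where "n \<ge> m" "(z + walk j w + walk n w', snd (w' n)) \<in> G"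
        using R unfolding hits_io_def by blast
      then show "\<exists>n\<ge>m. (z + walk n (comb_seq j w w'), snd (comb_seq j w w' n)) \<in> G"
        using *[of n] by (intro exI[of _ "j + n"]) (simp add: add.assoc)
    qed
  qed
qed

text \<open>Joint measurability in starting point and path is what makes the hitting probability a
  Borel function of the starting point.\<close>

lemma measurable_hits_io:
  fixes G :: "('a::euclidean_space \<times> 'a) set"
  assumes G: "G \<in> sets borel" and f: "f \<in> borel_measurable N" and g: "g \<in> measurable N path_space"
  shows "Measurable.pred N (\<lambda>x. g x \<in> hits_io G (f x))"
proof -
  have [measurable]: "G \<in> sets (borel \<Otimes>\<^sub>M borel)"
    using G unfolding borel_prod .
  note [measurable] = f g
  have [measurable]: "(\<lambda>x. walk n (g x)) \<in> borel_measurable N" for n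
    by (rule measurable_compose[OF g]) measurable
  have [measurable]: "(\<lambda>x. snd (g x n)) \<in> borel_measurable N" for n
    by (rule measurable_compose[OF g]) measurable
  show ?thesis
    unfolding hits_io_def mem_Collect_eq by measurable
qed

lemma hits_io_sets [measurable]: "G \<in> sets borel \<Longrightarrow> hits_io G z \<in> sets path_space"
  using measurable_hits_io[of G "\<lambda>_. z" path_space "\<lambda>w. w"] by (simp add: pred_def)

lemma measurable_hitting_time [measurable]:
  "hitting_time c n \<in> measurable path_space (count_space UNIV)"
  unfolding hitting_time_def by measurable

lemma hitting_timeI:
  assumes "\<exists>j\<ge>n. fst (w j) = c"
  shows "n \<le> hitting_time c n w" "fst (w (hitting_time c n w)) = c"
    "\<And>i. n \<le> i \<Longrightarrow> i < hitting_time c n w \<Longrightarrow> fst (w i) \<noteq> c"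
  using LeastI_ex[of "\<lambda>j. n \<le> j \<and> fst (w j) = c"] assms
  by (auto simp: hitting_time_def dest: not_less_Least)

lemma hitting_time_eq:
  assumes "n \<le> j" "fst (w j) = c" "\<And>i. n \<le> i \<Longrightarrow> i < j \<Longrightarrow> fst (w i) \<noteq> c"
  shows "hitting_time c n w = j"
  unfolding hitting_time_def using assms by (intro Least_equality) (auto simp: not_less[symmetric])

lemma prod_lessThan_add:
  fixes f :: "nat \<Rightarrow> 'a::comm_monoid_mult"
  shows "(\<Prod>i<j + k. f i) = (\<Prod>i<j. f i) * (\<Prod>i<k. f (j + i))"
  by (induction k) (simp_all add: mult.assoc)

section \<open>Markov properties and the zero-one law on path space\<close>

text \<open>Durations are integrated out, so \<open>Q a b\<close> is the law of the displacement
  alone. Working on path space makes it possible to glue two paths by \<open>comb_seq\<close>, and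
  the cylinder probabilities determine the laws.\<close>

locale markov_additive =
  fixes K :: "'s::countable \<Rightarrow> 's pmf"
    and Q :: "'s \<Rightarrow> 's \<Rightarrow> 'a::euclidean_space measure"
    and L :: "'s \<Rightarrow> (nat \<Rightarrow> 's \<times> 'a) measure"
  assumes prob_L: "prob_space (L c)"
    and sets_L [measurable_cong]: "sets (L c) = sets path_space"
    and prob_Q: "prob_space (Q a b)"
    and sets_Q: "sets (Q a b) = sets borel"
    and law_cylinder: "(\<And>i. B i \<in> sets borel) \<Longrightarrow> measure (L c) (path_cylinder n x B) =
      (if x 0 = c then \<Prod>i<n. pmf (K (x i)) (x (Suc i)) * measure (Q (x i) (x (Suc i))) (B i) else 0)"
begin

lemma space_L [simp]: "space (L c) = UNIV"
  using sets_eq_imp_space_eq[OF sets_L] by simp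

lemma emeasure_L: "emeasure (L c) A = ennreal (measure (L c) A)"
  using prob_L by (simp add: finite_measure.emeasure_eq_measure prob_space_def)

lemma sigma_finite_L: "sigma_finite_measure (L c)"
  using prob_L by (simp add: prob_space_imp_sigma_finite)

lemma AE_start: "AE w in L c. fst (w 0) = c"
proof -
  have "AE w in L c. \<forall>b. b \<noteq> c \<longrightarrow> fst (w 0) \<noteq> b"
  proof (unfold AE_all_countable, intro allI)
    fix b
    show "AE w in L c. b \<noteq> c \<longrightarrow> fst (w 0) \<noteq> b"
    proof (cases "b = c")
      case False
      have "measure (L c) (path_cylinder 0 (\<lambda>_. b) (\<lambda>_. UNIV)) = 0"
        using False by (subst law_cylinder) auto
      moreover have "path_cylinder 0 (\<lambda>_. b) (\<lambda>_. UNIV :: 'a set) \<in> sets (L c)"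
        unfolding sets_L by (rule path_cylinder_sets) simp
      ultimately have "path_cylinder 0 (\<lambda>_. b) (\<lambda>_. UNIV) \<in> null_sets (L c)"
        by (simp add: null_sets_def emeasure_L)
      from AE_not_in[OF this] show ?thesis
        by (simp add: path_cylinder_def)
    qed simp
  qed
  then show ?thesis
    by (rule eventually_mono) blast
qed

text \<open>As functions of \<open>\<Psi>\<close> both sides are finite measures, so it suffices to
  compare them on cylinders reaching beyond \<open>j\<close>, whose product formula splits at
  \<open>j\<close>.\<close>

lemma markov_property:
  assumes \<Psi>: "\<Psi> \<in> sets path_space"
  shows "emeasure (L c) {w\<in>\<Psi>. fst (w j) = b} =
    (\<integral>\<^sup>+w. indicator {w. fst (w j) = b} w * emeasure (L b) {w'. comb_seq j w w' \<in> \<Psi>} \<partial>L c)"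
proof -
  interpret Lb: sigma_finite_measure "L b"
    by (rule sigma_finite_L)
  have ev: "{w. fst (w j) = b} \<in> sets path_space" for b :: 's
  proof -
    have "Measurable.pred path_space (\<lambda>w. fst (w j) = b)"
      by measurable
    then show ?thesis
      by (simp add: pred_def)
  qed
  \<comment> \<open>\<open>N1\<close> is the path law restricted to paths that are in
    \<open>b\<close> at time \<open>j\<close>; \<open>N2\<close> below is the law of such a path
    glued at \<open>j\<close> to an independent path from \<open>b\<close>.\<close>
  define N1 where "N1 = density (L c) (indicator {w. fst (w j) = b})"
  have N1_eq: "emeasure N1 A = emeasure (L c) {w\<in>A. fst (w j) = b}" if "A \<in> sets path_space" for A
  proof -
    have "emeasure N1 A = (\<integral>\<^sup>+w. indicator {w. fst (w j) = b} w * indicator A w \<partial>L c)"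
      unfolding N1_def using that ev by (intro emeasure_density) (simp_all add: sets_L)
    also have "\<dots> = (\<integral>\<^sup>+w. indicator {w\<in>A. fst (w j) = b} w \<partial>L c)"
      by (intro nn_integral_cong) (simp split: split_indicator)
    also have "\<dots> = emeasure (L c) {w\<in>A. fst (w j) = b}"
      using sets.Int[OF that ev[of b]] by (intro nn_integral_indicator) (simp add: sets_L Int_def)
    finally show ?thesis .
  qed
  define N2 where "N2 = distr (N1 \<Otimes>\<^sub>M L b) path_space (\<lambda>(w, w'). comb_seq j w w')"
  have sets_N1 [measurable_cong]: "sets N1 = sets path_space"
    by (simp add: N1_def sets_L)
  have N2_eq: "emeasure N2 A = (\<integral>\<^sup>+w. indicator {w. fst (w j) = b} w * emeasure (L b) {w'. comb_seq j w w' \<in> A} \<partial>L c)"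
    if A [measurable]: "A \<in> sets path_space" for A
  proof -
    have meas: "(\<lambda>(w, w'). comb_seq j w w') \<in> measurable (N1 \<Otimes>\<^sub>M L b) path_space"
      using measurable_comb_seq by (simp cong: measurable_cong_sets add: sets_pair_measure_cong[OF sets_N1 sets_L])
    have "emeasure N2 A = emeasure (N1 \<Otimes>\<^sub>M L b) ((\<lambda>(w, w'). comb_seq j w w') -` A \<inter> space (N1 \<Otimes>\<^sub>M L b))"
      unfolding N2_def by (rule emeasure_distr[OF meas A])
    also have "\<dots> = (\<integral>\<^sup>+w. emeasure (L b) {w'. comb_seq j w w' \<in> A} \<partial>N1)"
      by (subst Lb.emeasure_pair_measure_alt[OF measurable_sets[OF meas A]])
        (auto intro!: nn_integral_cong arg_cong[where f="emeasure (L b)"]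
          simp: space_pair_measure sets_eq_imp_space_eq[OF sets_N1])
    also have "\<dots> = (\<integral>\<^sup>+w. indicator {w. fst (w j) = b} w * emeasure (L b) {w'. comb_seq j w w' \<in> A} \<partial>L c)"
      unfolding N1_def
    proof (rule nn_integral_density)
      show "indicator {w. fst (w j) = b} \<in> borel_measurable (L c)"
        using ev by (simp add: sets_L)
      have "(\<lambda>w. emeasure (L b) (Pair w -` {p \<in> space (L c \<Otimes>\<^sub>M L b). comb_seq j (fst p) (snd p) \<in> A})) \<in> borel_measurable (L c)"
        by (rule Lb.measurable_emeasure_Pair) measurable
      then show "(\<lambda>w. emeasure (L b) {w'. comb_seq j w w' \<in> A}) \<in> borel_measurable (L c)"
        by (simp add: space_pair_measure)
    qed
    finally show ?thesis .
  qed
  have "N1 = N2"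
  proof (rule measure_eqI_generator_eq[where E="path_cylinders j" and \<Omega>=UNIV and A="\<lambda>_. UNIV"])
    show "Int_stable (path_cylinders j :: (nat \<Rightarrow> 's \<times> 'a) set set)"
      by (rule Int_stable_path_cylinders)
    show "sets N1 = sigma_sets UNIV (path_cylinders j)" "sets N2 = sigma_sets UNIV (path_cylinders j)"
      unfolding sets_N1 sets_path_space[of j, symmetric] by (simp_all add: N2_def)
    show "range (\<lambda>_::nat. UNIV) \<subseteq> (path_cylinders j :: (nat \<Rightarrow> 's \<times> 'a) set set)"
      by (auto simp: path_cylinders_def)
    show "emeasure N1 UNIV \<noteq> \<infinity>"
      by (subst N1_eq) (auto simp: emeasure_L sets.top[of path_space, simplified])
    fix A :: "(nat \<Rightarrow> 's \<times> 'a) set" assume "A \<in> path_cylinders j"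
    then consider "A = UNIV" | "A = {}" | n x B where "A = path_cylinder n x B" "j \<le> n" "\<And>i. B i \<in> sets borel"
      unfolding path_cylinders_def by blast
    then show "emeasure N1 A = emeasure N2 A"
    proof cases
      case 1
      have U: "UNIV \<in> sets (path_space :: (nat \<Rightarrow> 's \<times> 'a) measure)"
        using sets.top[of path_space] by simp
      have "emeasure (L b) UNIV = 1"
        using prob_space.emeasure_space_1[OF prob_L[of b]] by simp
      then have "emeasure N2 A = (\<integral>\<^sup>+w. indicator {w. fst (w j) = b} w \<partial>L c)"
        unfolding 1 N2_eq[OF U] by simp
      also have "\<dots> = emeasure (L c) {w. fst (w j) = b}"
        by (rule nn_integral_indicator) (simp only: ev sets_L)
      also have "\<dots> = emeasure N1 A"
        unfolding 1 N1_eq[OF U] by simp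
      finally show ?thesis ..
    next
      case 2
      then show ?thesis
        by simp
    next
      case 3
      note B = 3(3)
      have A: "A \<in> sets path_space"
        unfolding 3(1) by (rule path_cylinder_sets[OF B])
      define R where "R = path_cylinder (n - j) (\<lambda>i. x (j + i)) (\<lambda>i. B (j + i))"
      define F where "F = path_cylinder j x B"
      have F: "F \<in> sets path_space"
        unfolding F_def by (rule path_cylinder_sets[OF B])
      have R: "measure (L b) R = (if x j = b then \<Prod>i<n - j. pmf (K (x (j + i))) (x (Suc (j + i))) *
          measure (Q (x (j + i)) (x (Suc (j + i)))) (B (j + i)) else 0)"
        unfolding R_def by (subst law_cylinder) (auto simp: B)
      \<comment> \<open>Entry \<open>j\<close> of \<open>w\<close> is overwritten by entry 0 of
        \<open>w'\<close>. That \<open>F\<close> still tests the state of \<open>w\<close> at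
        \<open>j\<close> is harmless, because this state is \<open>b = x j\<close>.\<close>
      have comb: "comb_seq j w w' \<in> A \<longleftrightarrow> w \<in> F \<and> w' \<in> R"
        if "fst (w j) = b" "x j = b" for w w'
      proof -
        have "comb_seq j w w' \<in> A \<longleftrightarrow>
          (\<forall>i<j. fst (w i) = x i \<and> snd (w i) \<in> B i) \<and> w' \<in> R"
        proof -
          have "(\<forall>i\<le>n. fst (comb_seq j w w' i) = x i) \<longleftrightarrow>
              (\<forall>i<j. fst (w i) = x i) \<and> (\<forall>i\<le>n - j. fst (w' i) = x (j + i))"
          proof safe
            fix i assume *: "\<forall>i\<le>n. fst (comb_seq j w w' i) = x i"
            show "fst (w i) = x i" if "i < j"
              using *[rule_format, of i] that 3(2) by (simp add: comb_seq_def)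
            show "fst (w' i) = x (j + i)" if "i \<le> n - j"
              using *[rule_format, of "j + i"] that 3(2) by (simp add: comb_seq_def)
          next
            fix i assume *: "\<forall>i<j. fst (w i) = x i" "\<forall>i\<le>n - j. fst (w' i) = x (j + i)" "i \<le> n"
            then show "fst (comb_seq j w w' i) = x i"
              using *(2)[rule_format, of "i - j"] by (auto simp: comb_seq_def)
          qed
          moreover have "(\<forall>i<n. snd (comb_seq j w w' i) \<in> B i) \<longleftrightarrow>
              (\<forall>i<j. snd (w i) \<in> B i) \<and> (\<forall>i<n - j. snd (w' i) \<in> B (j + i))"
          proof safe
            fix i assume *: "\<forall>i<n. snd (comb_seq j w w' i) \<in> B i"
            show "snd (w i) \<in> B i" if "i < j"
              using *[rule_format, of i] that 3(2) by (simp add: comb_seq_def)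
            show "snd (w' i) \<in> B (j + i)" if "i < n - j"
              using *[rule_format, of "j + i"] that 3(2) by (simp add: comb_seq_def)
          next
            fix i assume *: "\<forall>i<j. snd (w i) \<in> B i" "\<forall>i<n - j. snd (w' i) \<in> B (j + i)" "i < n"
            then show "snd (comb_seq j w w' i) \<in> B i"
              using *(2)[rule_format, of "i - j"] by (cases "i < j") (simp_all add: comb_seq_def)
          qed
          ultimately show ?thesis
            unfolding 3(1) R_def path_cylinder_def mem_Collect_eq by blast
        qed
        also have "(\<forall>i<j. fst (w i) = x i \<and> snd (w i) \<in> B i) \<longleftrightarrow> w \<in> F"
          using that by (auto simp: F_def path_cylinder_def le_less)
        finally show ?thesis .
      qed
      show ?thesis
      proof (cases "x j = b")
        case True
        have "emeasure N2 A = (\<integral>\<^sup>+w. indicator F w * emeasure (L b) R \<partial>L c)"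
          unfolding N2_eq[OF A]
        proof (rule nn_integral_cong)
          fix w
          have "w \<in> F \<Longrightarrow> fst (w j) = b"
            using True by (simp add: F_def path_cylinder_def)
          then show "indicator {w. fst (w j) = b} w * emeasure (L b) {w'. comb_seq j w w' \<in> A} =
              indicator F w * emeasure (L b) R"
            using comb[of w] True by (cases "fst (w j) = b"; cases "w \<in> F") simp_all
        qed
        also have "\<dots> = emeasure (L c) F * emeasure (L b) R"
          using F by (simp add: nn_integral_multc sets_L)
        also have "\<dots> = emeasure (L c) A"
        proof -
          have "measure (L c) F * measure (L b) R = measure (L c) A"
            using 3(2) prod_lessThan_add[of "\<lambda>i. pmf (K (x i)) (x (Suc i)) * measure (Q (x i) (x (Suc i))) (B i)" j "n - j"]
            unfolding F_def 3(1) R by (simp add: law_cylinder B True)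
          then show ?thesis
            by (simp add: emeasure_L ennreal_mult'[symmetric])
        qed
        also have "\<dots> = emeasure N1 A"
        proof -
          have "{w\<in>A. fst (w j) = b} = A"
            using True 3(1,2) by (auto simp: path_cylinder_def)
          then show ?thesis
            by (simp add: N1_eq[OF A])
        qed
        finally show ?thesis ..
      next
        \<comment> \<open>The continuation starts in \<open>b\<close> almost surely but the cylinder
          demands \<open>x j\<close> at its start, so \<open>R\<close> is null; on the other side no
          path of the cylinder is in \<open>b\<close> at time \<open>j\<close>.\<close>
        case False
        have "emeasure (L b) {w'. comb_seq j w w' \<in> A} = 0" for w
        proof -
          have "{w'. comb_seq j w w' \<in> A} \<subseteq> R"
          proof
            fix w' assume "w' \<in> {w'. comb_seq j w w' \<in> A}"
            then have *: "i \<le> n \<Longrightarrow> fst (comb_seq j w w' i) = x i" "i < n \<Longrightarrow> snd (comb_seq j w w' i) \<in> B i" for i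
              unfolding 3(1) path_cylinder_def by blast+
            have "fst (w' i) = x (j + i)" if "i \<le> n - j" for i
              using *(1)[of "j + i"] that 3(2) by (simp add: comb_seq_def)
            moreover have "snd (w' i) \<in> B (j + i)" if "i < n - j" for i
              using *(2)[of "j + i"] that 3(2) by (simp add: comb_seq_def)
            ultimately show "w' \<in> R"
              unfolding R_def path_cylinder_def by blast
          qed
          moreover have "R \<in> sets (L b)"
            unfolding R_def sets_L by (rule path_cylinder_sets[OF B])
          ultimately have "emeasure (L b) {w'. comb_seq j w w' \<in> A} \<le> emeasure (L b) R"
            by (rule emeasure_mono)
          then show ?thesis
            using R False by (simp add: emeasure_L)
        qed
        then have "emeasure N2 A = 0"
          by (simp add: N2_eq[OF A])
        moreover have "{w\<in>A. fst (w j) = b} = {}"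
          using False 3(1,2) by (auto simp: path_cylinder_def)
        then have "emeasure N1 A = 0"
          by (simp only: N1_eq[OF A] emeasure_empty)
        ultimately show ?thesis
          by simp
      qed
    qed
  qed auto
  then show ?thesis
    using N1_eq[OF \<Psi>] N2_eq[OF \<Psi>] by simp
qed

lemma measurable_emeasure_section:
  assumes "{p. P (fst p) (snd p)} \<in> sets (path_space \<Otimes>\<^sub>M path_space)"
  shows "(\<lambda>w. emeasure (L b) {w'. P w w'}) \<in> borel_measurable path_space"
proof -
  interpret Lb: sigma_finite_measure "L b"
    by (rule sigma_finite_L)
  have "(\<lambda>w. emeasure (L b) (Pair w -` {p. P (fst p) (snd p)})) \<in> borel_measurable path_space"
    using assms by (intro Lb.measurable_emeasure_Pair) (simp add: sets_pair_measure_cong[OF refl sets_L])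
  then show ?thesis
    by simp
qed

text \<open>The Markov property applied to the complement of \<open>\<Psi>\<close>: an integral of a
  nonnegative function vanishes iff the integrand vanishes almost everywhere.\<close>

lemma markov_property_AE:
  assumes \<Psi>: "\<Psi> \<in> sets path_space"
  shows "(AE w in L c. fst (w j) = b \<longrightarrow> w \<in> \<Psi>) \<longleftrightarrow>
    (AE w in L c. fst (w j) = b \<longrightarrow> (AE w' in L b. comb_seq j w w' \<in> \<Psi>))"
proof -
  have [measurable]: "\<Psi> \<in> sets path_space"
    by fact
  have pred: "Measurable.pred path_space (\<lambda>w. \<not> (fst (w j) = b \<longrightarrow> w \<in> \<Psi>))"
    by measurable
  have "Measurable.pred (path_space \<Otimes>\<^sub>M path_space) (\<lambda>p. \<not> comb_seq j (fst p) (snd p) \<in> \<Psi>)"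
    by measurable
  then have m: "(\<lambda>w. emeasure (L b) {w'. comb_seq j w w' \<notin> \<Psi>}) \<in> borel_measurable path_space"
    by (intro measurable_emeasure_section) (simp add: pred_def space_pair_measure)
  have "(AE w in L c. fst (w j) = b \<longrightarrow> w \<in> \<Psi>) \<longleftrightarrow> emeasure (L c) {w\<in>- \<Psi>. fst (w j) = b} = 0"
    using pred by (subst AE_iff_measurable[of "{w\<in>- \<Psi>. fst (w j) = b}"]) (auto simp: pred_def sets_L Collect_conj_eq)
  also have "\<dots> \<longleftrightarrow> (\<integral>\<^sup>+w. indicator {w. fst (w j) = b} w * emeasure (L b) {w'. comb_seq j w w' \<notin> \<Psi>} \<partial>L c) = 0"
    using \<Psi> sets.compl_sets[OF \<Psi>] by (subst markov_property) (simp_all add: Compl_eq_Diff_UNIV)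
  also have "\<dots> \<longleftrightarrow> (AE w in L c. indicator {w. fst (w j) = b} w * emeasure (L b) {w'. comb_seq j w w' \<notin> \<Psi>} = 0)"
  proof (rule nn_integral_0_iff_AE)
    have "Measurable.pred path_space (\<lambda>w. fst (w j) = b)"
      by measurable
    then have "{w. fst (w j) = b} \<in> sets (L c)"
      by (simp add: sets_L pred_def)
    then show "(\<lambda>w. indicator {w. fst (w j) = b} w * emeasure (L b) {w'. comb_seq j w w' \<notin> \<Psi>}) \<in> borel_measurable (L c)"
      using m by (intro borel_measurable_times_ennreal) (simp_all cong: measurable_cong_sets add: sets_L)
  qed
  also have "\<dots> \<longleftrightarrow> (AE w in L c. fst (w j) = b \<longrightarrow> (AE w' in L b. comb_seq j w w' \<in> \<Psi>))"
  proof -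
    have "(AE w' in L b. comb_seq j w w' \<in> \<Psi>) \<longleftrightarrow> emeasure (L b) {w'. comb_seq j w w' \<notin> \<Psi>} = 0" for w
    proof (rule AE_iff_measurable)
      have "Measurable.pred (L b) (\<lambda>w'. comb_seq j w w' \<notin> \<Psi>)"
        by measurable
      then show "{w'. comb_seq j w w' \<notin> \<Psi>} \<in> sets (L b)"
        by (simp add: pred_def)
    qed simp
    then show ?thesis
      by (intro AE_cong) (simp split: split_indicator)
  qed
  finally show ?thesis .
qed

text \<open>In the induction a visit after time \<open>n\<close> already suffices, and a visit at
  exactly \<open>n\<close> is followed by another return, by the Markov property at
  \<open>n\<close>.\<close>

lemma AE_visits:
  assumes "AE w in L c. \<exists>j\<ge>1. fst (w j) = c"
  shows "AE w in L c. \<exists>j\<ge>n. fst (w j) = c"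
proof (induction n)
  case 0
  show ?case
    using AE_start by (rule eventually_mono) auto
next
  case (Suc n)
  define R where "R = {w :: nat \<Rightarrow> 's \<times> 'a. \<exists>j\<ge>Suc n. fst (w j) = c}"
  have "Measurable.pred path_space (\<lambda>w :: nat \<Rightarrow> 's \<times> 'a. \<exists>j\<ge>Suc n. fst (w j) = c)"
    by measurable
  then have R: "R \<in> sets path_space"
    by (simp add: R_def pred_def)
  have "AE w' in L c. comb_seq n w w' \<in> R" for w
    using assms
  proof (rule eventually_mono)
    fix w' :: "nat \<Rightarrow> 's \<times> 'a" assume "\<exists>j\<ge>1. fst (w' j) = c"
    then obtain j where "1 \<le> j" "fst (w' j) = c"
      by blast
    then show "comb_seq n w w' \<in> R"
      unfolding R_def by (intro CollectI exI[of _ "n + j"]) (simp add: comb_seq_def)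
  qed
  then have "AE w in L c. fst (w n) = c \<longrightarrow> w \<in> R"
    by (subst markov_property_AE[OF R]) simp
  with Suc show ?case
  proof eventually_elim
    case (elim w)
    then obtain j where "n \<le> j" "fst (w j) = c"
      by blast
    with elim show ?case
      by (cases "j = n") (auto simp: R_def intro!: exI[of _ j])
  qed
qed

lemma strong_markov_property:
  assumes \<Psi>: "\<Psi> \<in> sets path_space" and rec: "AE w in L c. \<exists>j\<ge>n. fst (w j) = c"
  shows "emeasure (L c) \<Psi> =
    (\<integral>\<^sup>+w. emeasure (L c) {w'. comb_seq (hitting_time c n w) w w' \<in> \<Psi>} \<partial>L c)"
proof -
  have [measurable]: "\<Psi> \<in> sets path_space"
    by fact
  \<comment> \<open>\<open>V j\<close> depends on the entries before \<open>j\<close> only, hence is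
    unchanged by gluing at \<open>j\<close>. Intersected with a visit at \<open>j\<close> it says
    that the hitting time is \<open>j\<close>, which reduces the claim to fixed times.\<close>
  define V where "V j = {w :: nat \<Rightarrow> 's \<times> 'a. n \<le> j \<and> (\<forall>i<j. n \<le> i \<longrightarrow> fst (w i) \<noteq> c)}" for j
  define H where "H j = {w\<in>V j. fst (w j) = c}" for j
  have V: "V j \<in> sets path_space" for j
  proof -
    have "Measurable.pred path_space (\<lambda>w :: nat \<Rightarrow> 's \<times> 'a. n \<le> j \<and> (\<forall>i<j. n \<le> i \<longrightarrow> fst (w i) \<noteq> c))"
      by measurable
    then show ?thesis
      by (simp add: V_def pred_def)
  qed
  have H_iff: "w \<in> H j \<longleftrightarrow> j = hitting_time c n w" if "\<exists>j\<ge>n. fst (w j) = c" for w j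
    using hitting_timeI[OF that] hitting_time_eq[of n j w c] by (auto simp: H_def V_def)
  have H_time: "hitting_time c n w = j" if "w \<in> H j" for w j
    using that by (intro hitting_time_eq) (auto simp: H_def V_def)
  have H: "H j \<in> sets path_space" for j
  proof -
    have [measurable]: "V j \<in> sets path_space"
      by (rule V)
    have "Measurable.pred path_space (\<lambda>w. w \<in> V j \<and> fst (w j) = c)"
      by measurable
    then show ?thesis
      by (simp add: H_def pred_def)
  qed
  have disj: "disjoint_family H"
    unfolding disjoint_family_on_def using H_time by blast
  have piece: "emeasure (L c) (\<Psi> \<inter> H j) =
      (\<integral>\<^sup>+w. indicator (H j) w * emeasure (L c) {w'. comb_seq (hitting_time c n w) w w' \<in> \<Psi>} \<partial>L c)" for j
  proof -
    have "emeasure (L c) (\<Psi> \<inter> H j) = emeasure (L c) {w\<in>\<Psi> \<inter> V j. fst (w j) = c}"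
      by (rule arg_cong[where f="emeasure (L c)"]) (auto simp: H_def)
    also have "\<dots> = (\<integral>\<^sup>+w. indicator {w. fst (w j) = c} w * emeasure (L c) {w'. comb_seq j w w' \<in> \<Psi> \<inter> V j} \<partial>L c)"
      using V \<Psi> by (intro markov_property) blast
    also have "\<dots> = (\<integral>\<^sup>+w. indicator (H j) w * emeasure (L c) {w'. comb_seq (hitting_time c n w) w w' \<in> \<Psi>} \<partial>L c)"
    proof (rule nn_integral_cong)
      fix w
      have "comb_seq j w w' \<in> V j \<longleftrightarrow> w \<in> V j" for w'
        by (auto simp: V_def comb_seq_def)
      then show "indicator {w. fst (w j) = c} w * emeasure (L c) {w'. comb_seq j w w' \<in> \<Psi> \<inter> V j} =
          indicator (H j) w * emeasure (L c) {w'. comb_seq (hitting_time c n w) w w' \<in> \<Psi>}"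
        using H_time[of w j] by (cases "w \<in> V j") (auto simp: H_def split: split_indicator)
    qed
    finally show ?thesis .
  qed
  have "Measurable.pred (path_space \<Otimes>\<^sub>M path_space) (\<lambda>p. comb_seq (hitting_time c n (fst p)) (fst p) (snd p) \<in> \<Psi>)"
  proof (rule measurable_compose_countable[of "\<lambda>j p. comb_seq j (fst p) (snd p) \<in> \<Psi>"])
    show "Measurable.pred (path_space \<Otimes>\<^sub>M path_space) (\<lambda>p. comb_seq j (fst p) (snd p) \<in> \<Psi>)" for j
      by measurable
    show "(\<lambda>p. hitting_time c n (fst p)) \<in> measurable (path_space \<Otimes>\<^sub>M path_space) (count_space UNIV)"
      by (rule measurable_compose[OF measurable_fst measurable_hitting_time])
  qed
  then have f: "(\<lambda>w. emeasure (L c) {w'. comb_seq (hitting_time c n w) w w' \<in> \<Psi>}) \<in> borel_measurable (L c)"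
    using measurable_emeasure_section[of "\<lambda>w w'. comb_seq (hitting_time c n w) w w' \<in> \<Psi>" c]
    by (simp add: pred_def space_pair_measure cong: measurable_cong_sets[OF sets_L refl])
  have "emeasure (L c) \<Psi> = emeasure (L c) (\<Union>j. \<Psi> \<inter> H j)"
  proof (rule emeasure_eq_AE)
    show "AE w in L c. w \<in> \<Psi> \<longleftrightarrow> w \<in> (\<Union>j. \<Psi> \<inter> H j)"
      using rec by (rule eventually_mono) (simp add: H_iff)
    show "\<Psi> \<in> sets (L c)"
      using \<Psi> by (simp add: sets_L)
    show "(\<Union>j. \<Psi> \<inter> H j) \<in> sets (L c)"
      using \<Psi> H by (intro sets.countable_UN) (auto simp: sets_L)
  qed
  also have "\<dots> = (\<Sum>j. emeasure (L c) (\<Psi> \<inter> H j))"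
  proof (rule suminf_emeasure[symmetric])
    show "range (\<lambda>j. \<Psi> \<inter> H j) \<subseteq> sets (L c)"
      using \<Psi> H by (auto simp: sets_L)
    show "disjoint_family (\<lambda>j. \<Psi> \<inter> H j)"
      by (rule disjoint_family_subset[OF disj]) blast
  qed
  also have "\<dots> = (\<integral>\<^sup>+w. (\<Sum>j. indicator (H j) w * emeasure (L c) {w'. comb_seq (hitting_time c n w) w w' \<in> \<Psi>}) \<partial>L c)"
    unfolding piece using f H
    by (intro nn_integral_suminf[symmetric] borel_measurable_times_ennreal) (simp_all add: sets_L)
  also have "\<dots> = (\<integral>\<^sup>+w. emeasure (L c) {w'. comb_seq (hitting_time c n w) w w' \<in> \<Psi>} \<partial>L c)"
  proof (rule nn_integral_cong_AE, use rec in eventually_elim)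
    case (elim w)
    then show ?case
      using suminf_cmult_indicator[OF disj, of w "hitting_time c n w"
          "\<lambda>_. emeasure (L c) {w'. comb_seq (hitting_time c n w) w w' \<in> \<Psi>}"]
      by (simp add: H_iff mult.commute)
  qed
  finally show ?thesis .
qed

lemma zero_one_hits_io:
  assumes G: "G \<in> sets borel" and rec: "AE w in L c. \<exists>j\<ge>1. fst (w j) = c"
  shows "measure (L c) (hits_io G 0) \<in> {0, 1}"
proof -
  interpret prob_space "L c"
    by (rule prob_L)
  define h where "h z = measure (L c) (hits_io G z)" for z
  note visits = AE_visits[OF rec]
  have h0: "0 \<le> h z" and h1: "h z \<le> 1" for z
    unfolding h_def by simp_all
  have h_meas: "h \<in> borel_measurable borel"
  proof -
    have "Measurable.pred (borel \<Otimes>\<^sub>M path_space) (\<lambda>p. snd p \<in> hits_io G (fst p))"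
      by (rule measurable_hits_io[OF G]) simp_all
    then have "{p. snd p \<in> hits_io G (fst p)} \<in> sets (borel \<Otimes>\<^sub>M L c)"
      by (simp add: pred_def space_pair_measure sets_pair_measure_cong[OF refl sets_L])
    then have "(\<lambda>z. emeasure (L c) (Pair z -` {p. snd p \<in> hits_io G (fst p)})) \<in> borel_measurable borel"
      by (rule measurable_emeasure_Pair)
    then show ?thesis
      unfolding h_def measure_def by simp
  qed
  have walk_meas: "(\<lambda>w. walk (hitting_time c n w) w) \<in> borel_measurable (L c)" for n
  proof -
    have "(\<lambda>w. walk (hitting_time c n w) w) \<in> borel_measurable path_space"
      by (rule measurable_compose_countable[of walk]) measurable
    then show ?thesis
      by (simp cong: measurable_cong_sets[OF sets_L refl])
  qed
  have h_walk: "AE w in L c. h (walk (hitting_time c n w) w) = h 0" for n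
  proof -
    \<comment> \<open>The strong Markov property at the first visit from \<open>n\<close> on makes
      \<open>h\<close> harmonic for this law, for each \<open>n\<close> on its own.\<close>
    define \<nu> where "\<nu> = distr (L c) borel (\<lambda>w. walk (hitting_time c n w) w)"
    have "AE y in \<nu>. h (0 + y) = h 0"
    proof (rule choquet_deny[OF _ _ h_meas h0 h1])
      show "prob_space \<nu>"
        unfolding \<nu>_def by (rule prob_space_distr[OF walk_meas])
      show "sets \<nu> = sets borel"
        by (simp add: \<nu>_def)
      fix z
      have hz: "(\<lambda>y. h (z + y)) \<in> borel_measurable borel"
        by (rule measurable_compose[OF _ h_meas]) measurable
      have "ennreal (h z) = emeasure (L c) (hits_io G z)"
        by (simp add: h_def emeasure_L)
      also have "\<dots> = (\<integral>\<^sup>+w. ennreal (h (z + walk (hitting_time c n w) w)) \<partial>L c)"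
        by (subst strong_markov_property[OF hits_io_sets[OF G] visits])
          (simp add: comb_seq_in_hits_io h_def emeasure_L)
      also have "\<dots> = (\<integral>\<^sup>+y. ennreal (h (z + y)) \<partial>\<nu>)"
        unfolding \<nu>_def using hz by (subst nn_integral_distr[OF walk_meas]) simp_all
      finally have "ennreal (h z) = (\<integral>\<^sup>+y. ennreal (h (z + y)) \<partial>\<nu>)" .
      then have "enn2real (\<integral>\<^sup>+y. ennreal (h (z + y)) \<partial>\<nu>) = h z"
        using h0[of z] by (metis enn2real_ennreal)
      then show "h z = (\<integral>y. h (z + y) \<partial>\<nu>)"
        using hz h0 by (subst integral_eq_nn_integral) (simp_all add: \<nu>_def)
    qed
    then show ?thesis
      unfolding \<nu>_def using h_meas by (subst (asm) AE_distr_iff[OF walk_meas]) simp_all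
  qed
  have hits: "hits_io G 0 \<in> sets (L c)"
    by (simp add: sets_L hits_io_sets[OF G])
  \<comment> \<open>Equality of \<open>N1\<close> and \<open>N2\<close> expresses independence of
    the event from everything; evaluated at the event itself it gives
    \<open>h 0 = h 0 * h 0\<close>.\<close>
  define N1 where "N1 = density (L c) (indicator (hits_io G 0))"
  define N2 where "N2 = density (L c) (\<lambda>_. ennreal (h 0))"
  have N1: "emeasure N1 A = emeasure (L c) (hits_io G 0 \<inter> A)" if "A \<in> sets path_space" for A
    unfolding N1_def using that hits
    by (subst emeasure_density) (simp_all add: sets_L indicator_inter_arith[symmetric])
  have N2: "emeasure N2 A = ennreal (h 0) * emeasure (L c) A" if "A \<in> sets path_space" for A
    unfolding N2_def using that by (subst emeasure_density) (simp_all add: sets_L nn_integral_cmult)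
  \<comment> \<open>An event about the first \<open>n\<close> entries survives gluing at a time at
    least \<open>n\<close>, and by \<open>h_walk\<close> the continuation then hits infinitely often
    with probability \<open>h 0\<close> almost surely.\<close>
  have cyl: "emeasure N1 A = emeasure N2 A"
    if A: "A \<in> sets path_space" and dep: "\<And>w w'. (\<And>i. i < n \<Longrightarrow> w i = w' i) \<Longrightarrow> w \<in> A \<longleftrightarrow> w' \<in> A" for A n
  proof -
    have "emeasure N1 A = (\<integral>\<^sup>+w. emeasure (L c) {w'. comb_seq (hitting_time c n w) w w' \<in> hits_io G 0 \<inter> A} \<partial>L c)"
      unfolding N1[OF A] using A hits_io_sets[OF G] by (intro strong_markov_property[OF _ visits]) blast
    also have "\<dots> = (\<integral>\<^sup>+w. ennreal (h 0) * indicator A w \<partial>L c)"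
    proof (rule nn_integral_cong_AE, use visits[of n] h_walk[of n] in eventually_elim)
      case (elim w)
      have "comb_seq (hitting_time c n w) w w' \<in> A \<longleftrightarrow> w \<in> A" for w'
        using hitting_timeI(1)[OF elim(1)] by (intro dep) (simp add: comb_seq_def)
      then have "{w'. comb_seq (hitting_time c n w) w w' \<in> hits_io G 0 \<inter> A} =
          (if w \<in> A then hits_io G (walk (hitting_time c n w) w) else {})"
        by (auto simp: comb_seq_in_hits_io)
      then show ?case
        using elim(2) by (simp add: emeasure_L h_def)
    qed
    also have "\<dots> = emeasure N2 A"
      using A by (simp add: N2[OF A] nn_integral_cmult sets_L)
    finally show ?thesis .
  qed
  have U: "UNIV \<in> sets (path_space :: (nat \<Rightarrow> 's \<times> 'a) measure)"
    using sets.top[of path_space] by simp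
  have "N1 = N2"
  proof (rule measure_eqI_generator_eq[where E="path_cylinders 0" and \<Omega>=UNIV and A="\<lambda>_. UNIV"])
    show "Int_stable (path_cylinders 0 :: (nat \<Rightarrow> 's \<times> 'a) set set)"
      by (rule Int_stable_path_cylinders)
    show "sets N1 = sigma_sets UNIV (path_cylinders 0)" "sets N2 = sigma_sets UNIV (path_cylinders 0)"
      unfolding sets_path_space[of 0, symmetric] by (simp_all add: N1_def N2_def sets_L)
    show "range (\<lambda>_::nat. UNIV) \<subseteq> (path_cylinders 0 :: (nat \<Rightarrow> 's \<times> 'a) set set)"
      by (auto simp: path_cylinders_def)
    show "emeasure N1 UNIV \<noteq> \<infinity>"
      by (simp add: N1[OF U] emeasure_L)
    fix A :: "(nat \<Rightarrow> 's \<times> 'a) set" assume "A \<in> path_cylinders 0"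
    then consider "A = UNIV" | "A = {}" | n x B where "A = path_cylinder n x B" "\<And>i. B i \<in> sets borel"
      unfolding path_cylinders_def by blast
    then show "emeasure N1 A = emeasure N2 A"
    proof cases
      case 1
      then show ?thesis
        using cyl[OF U] by simp
    next
      case 2
      then show ?thesis
        by simp
    next
      case 3
      show ?thesis
        unfolding 3(1)
      proof (rule cyl)
        show "path_cylinder n x B \<in> sets path_space"
          by (rule path_cylinder_sets[OF 3(2)])
        \<comment> \<open>\<open>Suc n\<close> entries are needed because a cylinder also tests the
          state at \<open>n\<close>.\<close>
        show "w \<in> path_cylinder n x B \<longleftrightarrow> w' \<in> path_cylinder n x B"
          if "\<And>i. i < Suc n \<Longrightarrow> w i = w' i" for w w'
          using that by (simp add: path_cylinder_def)
      qed
    qed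
  qed auto
  then have "ennreal (h 0) = ennreal (h 0 * h 0)"
    using N1[OF hits_io_sets[OF G, of 0]] N2[OF hits_io_sets[OF G, of 0]]
    by (simp add: h_def emeasure_L ennreal_mult'[symmetric])
  then have "h 0 = h 0 * h 0"
    using h0[of 0] by (simp add: ennreal_inj)
  then show ?thesis
    unfolding h_def[symmetric] by simp
qed

lemma measure_Q_UNIV [simp]: "measure (Q a b) UNIV = 1"
  using prob_space.prob_space[OF prob_Q[of a b]] sets_eq_imp_space_eq[OF sets_Q[of a b]] by simp

text \<open>Condition \<open>no_jump\<close> concerns possible transitions only, so it must be known
  that the path makes no others. A forbidden first transition has cylinder probability 0, and the
  Markov property carries this to every time.\<close>

lemma AE_transitions: "AE w in L c. \<forall>n. 0 < pmf (K (fst (w n))) (fst (w (Suc n)))"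
proof -
  have "AE w in L c. fst (w n) = a \<longrightarrow> fst (w (Suc n)) = b \<longrightarrow> 0 < pmf (K a) b" for n a b
  proof (cases "0 < pmf (K a) b")
    case False
    define T where "T = {w :: nat \<Rightarrow> 's \<times> 'a. fst (w (Suc n)) \<noteq> b}"
    have "Measurable.pred path_space (\<lambda>w :: nat \<Rightarrow> 's \<times> 'a. fst (w (Suc n)) \<noteq> b)"
      by measurable
    then have T: "T \<in> sets path_space"
      by (simp add: T_def pred_def)
    let ?N = "path_cylinder 1 (case_nat a (\<lambda>_. b)) (\<lambda>_. UNIV :: 'a set)"
    have "measure (L a) ?N = 0"
      using False pmf_nonneg[of "K a" b] by (subst law_cylinder) auto
    moreover have "?N \<in> sets (L a)"
      unfolding sets_L by (rule path_cylinder_sets) simp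
    ultimately have "?N \<in> null_sets (L a)"
      by (simp add: null_sets_def emeasure_L)
    from AE_not_in[OF this] AE_start[of a] have "AE w' in L a. fst (w' 1) \<noteq> b"
      by eventually_elim (auto simp: path_cylinder_def le_Suc_eq)
    then have "AE w in L c. fst (w n) = a \<longrightarrow> (AE w' in L a. comb_seq n w w' \<in> T)"
      by (simp add: T_def comb_seq_def)
    then have "AE w in L c. fst (w n) = a \<longrightarrow> w \<in> T"
      by (simp only: markov_property_AE[OF T])
    then show ?thesis
      by (rule eventually_mono) (simp add: T_def)
  qed simp
  then have "AE w in L c. \<forall>n a b. fst (w n) = a \<longrightarrow> fst (w (Suc n)) = b \<longrightarrow> 0 < pmf (K a) b"
    unfolding AE_all_countable by blast
  then show ?thesis
    by (rule eventually_mono) simp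
qed

text \<open>With positive probability the path from \<open>c\<close> is in \<open>b\<close> at some
  time \<open>n\<close>. Its continuation is a path from \<open>b\<close> displaced by a vector, and
  \<open>shift\<close> absorbs this vector by enlarging the index \<open>r\<close>.\<close>

lemma AE_never_hits_io_transfer:
  fixes G :: "nat \<Rightarrow> ('a \<times> 'a) set"
  assumes "irreducible_kernel K"
    and G: "\<And>r. G r \<in> sets borel"
    and shift: "\<And>z r. \<exists>r'. \<forall>x v. (x, v) \<in> G r \<longrightarrow> (z + x, v) \<in> G r'"
    and never: "AE w in L c. \<forall>r. w \<notin> hits_io (G r) 0"
  shows "AE w in L b. \<forall>r. w \<notin> hits_io (G r) 0"
proof -
  \<comment> \<open>A positive power of the kernel is turned into one explicit state sequence, since
    \<open>law_cylinder\<close> speaks of single sequences.\<close>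
  have path: "\<exists>x. x 0 = c \<and> x n = s \<and> (\<forall>i<n. 0 < pmf (K (x i)) (x (Suc i)))"
    if "0 < pmf (kernel_power K n c) s" for n s
    using that
  proof (induction n arbitrary: s)
    case 0
    then show ?case
      by (intro exI[of _ "\<lambda>_. c"]) (auto simp: indicator_def split: if_splits)
  next
    case (Suc n)
    then have "s \<in> set_pmf (kernel_power K (Suc n) c)"
      by (simp only: pmf_positive_iff)
    then obtain a where a: "a \<in> set_pmf (kernel_power K n c)" "s \<in> set_pmf (K a)"
      by auto
    then obtain x where x: "x 0 = c" "x n = a" "\<forall>i<n. 0 < pmf (K (x i)) (x (Suc i))"
      using Suc.IH[of a] by (auto simp: pmf_positive)
    show ?case
      using x a(2) by (intro exI[of _ "x(Suc n := s)"]) (auto simp: less_Suc_eq pmf_positive)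
  qed
  obtain n where "0 < pmf (kernel_power K n c) b"
    using assms(1) unfolding irreducible_kernel_def by blast
  then obtain x where x: "x 0 = c" "x n = b" "\<forall>i<n. 0 < pmf (K (x i)) (x (Suc i))"
    using path by blast
  have pos: "0 < measure (L c) (path_cylinder n x (\<lambda>_. UNIV))"
    using x by (subst law_cylinder) (auto intro!: prod_pos)
  define T where "T = {w :: nat \<Rightarrow> 's \<times> 'a. \<forall>r. w \<notin> hits_io (G r) 0}"
  have T: "T \<in> sets path_space"
  proof -
    have "T = (\<Inter>r. UNIV - hits_io (G r) 0)"
      by (auto simp: T_def)
    also have "\<dots> \<in> sets path_space"
      using hits_io_sets[OF G] sets.compl_sets[of _ path_space] by (intro sets.countable_INT) auto
    finally show ?thesis .
  qed
  have "AE w in L c. fst (w n) = b \<longrightarrow> w \<in> T"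
    using never by (rule eventually_mono) (simp add: T_def)
  then have restart: "AE w in L c. fst (w n) = b \<longrightarrow> (AE w' in L b. comb_seq n w w' \<in> T)"
    by (simp only: markov_property_AE[OF T])
  have "\<not> (AE w in L c. fst (w n) \<noteq> b)"
  proof
    assume *: "AE w in L c. fst (w n) \<noteq> b"
    have "AE w in L c. w \<notin> path_cylinder n x (\<lambda>_. UNIV)"
      using * by (rule eventually_mono) (use x in \<open>auto simp: path_cylinder_def\<close>)
    moreover have "path_cylinder n x (\<lambda>_. UNIV :: 'a set) \<in> sets (L c)"
      unfolding sets_L by (rule path_cylinder_sets) simp
    ultimately have "emeasure (L c) (path_cylinder n x (\<lambda>_. UNIV)) = 0"
      by (subst (asm) AE_iff_measurable[of "path_cylinder n x (\<lambda>_. UNIV)"]) auto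
    with pos show False
      by (simp add: emeasure_L)
  qed
  \<comment> \<open>One good initial segment is enough: the conclusion mentions only
    \<open>w'\<close>, and \<open>walk n w\<close> is then a fixed vector.\<close>
  then obtain w where w: "AE w' in L b. comb_seq n w w' \<in> T"
    using restart by (metis (mono_tags, lifting) eventually_mono)
  show ?thesis
    using w
  proof (rule eventually_mono)
    fix w' assume T': "comb_seq n w w' \<in> T"
    show "\<forall>r. w' \<notin> hits_io (G r) 0"
    proof (intro allI notI)
      fix r assume *: "w' \<in> hits_io (G r) 0"
      obtain r' where r': "\<forall>x v. (x, v) \<in> G r \<longrightarrow> (walk n w + x, v) \<in> G r'"
        using shift by blast
      have "w' \<in> hits_io (G r') (walk n w)"
        using * r' unfolding hits_io_def by (simp, metis)
      then have "comb_seq n w w' \<in> hits_io (G r') 0"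
        by (simp add: comb_seq_in_hits_io)
      with T' show False
        by (simp add: T_def)
    qed
  qed
qed

end

section \<open>The Markov Levy walk\<close>

definition skeleton_path ::
    "(nat \<Rightarrow> 'w \<Rightarrow> 's) \<Rightarrow> ('s \<Rightarrow> 's \<Rightarrow> nat \<Rightarrow> 'w \<Rightarrow> real \<times> 'a) \<Rightarrow> 'w \<Rightarrow> nat \<Rightarrow> 's \<times> 'a" where
  "skeleton_path C X \<omega> n = (C n \<omega>, snd (step C X (Suc n) \<omega>))"

lemma walk_skeleton_path: "walk n (skeleton_path C X \<omega>) = MRW C X n \<omega>"
  by (simp add: walk_def MRW_def skeleton_path_def sum.atLeast1_atMost_eq)

lemma renewal_time_Suc: "renewal_time C X (Suc n) \<omega> = renewal_time C X n \<omega> + fst (step C X (Suc n) \<omega>)"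
  by (simp add: renewal_time_def)

lemma MRW_Suc: "MRW C X (Suc n) \<omega> = MRW C X n \<omega> + snd (step C X (Suc n) \<omega>)"
  by (simp add: MRW_def)

lemma MLW_eq:
  "MLW C X t \<omega> = MRW C X (renewal_count C X t \<omega>) \<omega> +
    ((t - renewal_time C X (renewal_count C X t \<omega>) \<omega>) / fst (step C X (Suc (renewal_count C X t \<omega>)) \<omega>)) *\<^sub>R
      snd (step C X (Suc (renewal_count C X t \<omega>)) \<omega>)"
  by (simp add: MLW_def MRW_def Let_def)

section \<open>Pathwise properties of the interpolation\<close>

locale regular_sample =
  fixes C :: "nat \<Rightarrow> 'w \<Rightarrow> 's" and X :: "'s \<Rightarrow> 's \<Rightarrow> nat \<Rightarrow> 'w \<Rightarrow> real \<times> 'a::euclidean_space" and \<omega> :: 'w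
  assumes step_nonneg: "0 \<le> fst (step C X (Suc n) \<omega>)"
    and step_zero: "fst (step C X (Suc n) \<omega>) = 0 \<Longrightarrow> snd (step C X (Suc n) \<omega>) = 0"
    and finite_renewals: "0 \<le> t \<Longrightarrow> finite {n. renewal_time C X n \<omega> \<le> t}"
begin

abbreviation "B n \<equiv> renewal_time C X n \<omega>"
abbreviation "Z n \<equiv> MRW C X n \<omega>"
abbreviation "N t \<equiv> renewal_count C X t \<omega>"

lemma renewal_time_mono: "n \<le> k \<Longrightarrow> B n \<le> B k"
  by (rule lift_Suc_mono_le[of B]) (simp_all add: renewal_time_Suc step_nonneg)

lemma renewal_time_nonneg: "0 \<le> B n"
  using renewal_time_mono[of 0 n] by (simp add: renewal_time_def)

text \<open>Equal renewal times force all intermediate durations to be 0, and steps of duration 0 do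
  not move.\<close>

lemma MRW_eq_if_renewal_time_eq: "B (n + k) = B n \<Longrightarrow> Z (n + k) = Z n"
proof (induction k)
  case (Suc k)
  have "B n \<le> B (n + k)" "B (n + k) \<le> B (n + Suc k)"
    by (simp_all add: renewal_time_mono)
  then have "B (n + k) = B n" "fst (step C X (Suc (n + k)) \<omega>) = 0"
    using Suc.prems by (simp_all add: renewal_time_Suc)
  then show ?case
    using Suc.IH step_zero by (simp add: MRW_Suc)
qed simp

lemma renewal_count_props:
  assumes "0 \<le> t"
  shows "B (N t) \<le> t" "t < B (Suc (N t))" "B n \<le> t \<Longrightarrow> n \<le> N t"
proof -
  have fin: "finite {n. B n \<le> t}"
    by (rule finite_renewals[OF assms])
  have "0 \<in> {n. B n \<le> t}"
    using assms by (simp add: renewal_time_def)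
  then have "N t \<in> {n. B n \<le> t}"
    unfolding renewal_count_def by (intro Max_in fin) auto
  then show "B (N t) \<le> t"
    by simp
  show le: "n \<le> N t" if "B n \<le> t" for n
    unfolding renewal_count_def using that by (intro Max_ge fin) simp
  show "t < B (Suc (N t))"
    using le[of "Suc (N t)"] by (cases "B (Suc (N t)) \<le> t") auto
qed

text \<open>Every point of the segment is attained, although \<open>N\<close> skips to the last of
  several simultaneous renewals and division by a zero duration yields 0.\<close>

lemma MLW_on_segment:
  assumes s: "0 \<le> s" "s \<le> 1"
  shows "MLW C X (B n + s * fst (step C X (Suc n) \<omega>)) \<omega> = Z n + s *\<^sub>R snd (step C X (Suc n) \<omega>)"
proof -
  define \<tau> where "\<tau> = fst (step C X (Suc n) \<omega>)"
  define u where "u = B n + s * \<tau>"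
  have \<tau>: "0 \<le> \<tau>" "B (Suc n) = B n + \<tau>"
    by (simp_all add: \<tau>_def step_nonneg renewal_time_Suc)
  have u: "B n \<le> u" "u \<le> B (Suc n)"
    using \<tau> s mult_left_le_one_le[of \<tau> s] by (simp_all add: u_def)
  have "0 \<le> u"
    using renewal_time_nonneg[of n] u by linarith
  note N = renewal_count_props[OF this]
  have "n \<le> N u"
    by (rule N(3)[OF u(1)])
  have "MLW C X u \<omega> = Z n + s *\<^sub>R snd (step C X (Suc n) \<omega>)"
  proof (cases "N u = n")
    case True
    have "0 < \<tau>"
      using N(1,2) \<tau> unfolding True by linarith
    then show ?thesis
      unfolding MLW_eq True \<tau>_def[symmetric] by (simp add: u_def)
  next
    case False
    with \<open>n \<le> N u\<close> obtain k where k: "N u = Suc n + k"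
      using le_Suc_ex[of "Suc n" "N u"] by auto
    \<comment> \<open>Here the time \<open>u\<close> has reached the right end of the segment, and
      all renewals up to \<open>N u\<close> coincide with it. So \<open>s = 1\<close> or the
      duration is 0, and both sides are the end point.\<close>
    have eq: "B (Suc n + k) = B (Suc n)" "u = B (Suc n)"
      using renewal_time_mono[of "Suc n" "N u"] N(1) u(2) unfolding k by simp_all
    have "s * \<tau> = \<tau>"
      using eq(2) \<tau> by (simp add: u_def)
    then have "s = 1 \<or> \<tau> = 0"
      by auto
    then have "s *\<^sub>R snd (step C X (Suc n) \<omega>) = snd (step C X (Suc n) \<omega>)"
      using step_zero[of n] by (auto simp: \<tau>_def)
    then show ?thesis
      using MRW_eq_if_renewal_time_eq[OF eq(1)] eq unfolding MLW_eq k
      by (simp add: MRW_Suc)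
  qed
  then show ?thesis
    by (simp add: u_def \<tau>_def)
qed

text \<open>From time \<open>B k\<close> on only segments with index at least \<open>k\<close> are
  in use; conversely segments with index beyond \<open>N t\<close> are traversed after time
  \<open>t\<close>.\<close>

lemma MLW_io_iff:
  "(\<forall>t\<ge>0. \<exists>u\<ge>t. MLW C X u \<omega> \<in> A) \<longleftrightarrow>
    (\<forall>k. \<exists>n\<ge>k. \<exists>s\<in>{0..1}. Z n + s *\<^sub>R snd (step C X (Suc n) \<omega>) \<in> A)"
proof safe
  fix k assume "\<forall>t\<ge>0. \<exists>u\<ge>t. MLW C X u \<omega> \<in> A"
  then obtain u where u: "B k \<le> u" "MLW C X u \<omega> \<in> A"
    using renewal_time_nonneg by blast
  then have "0 \<le> u"
    using renewal_time_nonneg[of k] by linarith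
  note N = renewal_count_props[OF this]
  define \<tau> where "\<tau> = fst (step C X (Suc (N u)) \<omega>)"
  have \<tau>: "B (Suc (N u)) = B (N u) + \<tau>"
    by (simp add: \<tau>_def renewal_time_Suc)
  have "(u - B (N u)) / \<tau> \<in> {0..1}"
    using N(1,2) \<tau> by (auto simp: divide_le_eq_1)
  then show "\<exists>n\<ge>k. \<exists>s\<in>{0..1}. Z n + s *\<^sub>R snd (step C X (Suc n) \<omega>) \<in> A"
    using N(3)[OF u(1)] u(2) unfolding MLW_eq \<tau>_def by blast
next
  fix t :: real assume hit: "\<forall>k. \<exists>n\<ge>k. \<exists>s\<in>{0..1}. Z n + s *\<^sub>R snd (step C X (Suc n) \<omega>) \<in> A"
    and t: "0 \<le> t"
  obtain n s where ns: "Suc (N t) \<le> n" "s \<in> {0..1}" "Z n + s *\<^sub>R snd (step C X (Suc n) \<omega>) \<in> A"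
    using hit by blast
  have "t \<le> B n"
    using renewal_count_props(2)[OF t] renewal_time_mono[OF ns(1)] by linarith
  moreover have "0 \<le> s * fst (step C X (Suc n) \<omega>)"
    using ns(2) step_nonneg by simp
  ultimately show "\<exists>u\<ge>t. MLW C X u \<omega> \<in> A"
    using MLW_on_segment[of s n] ns(2,3)
    by (intro exI[of _ "B n + s * fst (step C X (Suc n) \<omega>)"]) auto
qed

end

section \<open>The law of the skeleton path\<close>

context markov_levy_walk
begin

lemma measurable_chain [measurable]: "C n \<in> measurable (Pr c) (count_space UNIV)"
  using chain[of c] by (simp add: markov_chain_def)

lemma measurable_array: "1 \<le> n \<Longrightarrow> X a b n \<in> borel_measurable (Pr c)"
  using array_indep[of c] unfolding prob_space.indep_vars_def[OF prob] by auto

lemma measurable_step: "step C X (Suc n) \<in> borel_measurable (Pr c)"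
proof -
  have "(\<lambda>\<omega>. X a (C (Suc n) \<omega>) (Suc n) \<omega>) \<in> borel_measurable (Pr c)" for a
    by (rule measurable_compose_countable[of "\<lambda>b. X a b (Suc n)"]) (simp_all add: measurable_array)
  then have "(\<lambda>\<omega>. X (C n \<omega>) (C (Suc n) \<omega>) (Suc n) \<omega>) \<in> borel_measurable (Pr c)"
    by (rule measurable_compose_countable[of "\<lambda>a \<omega>. X a (C (Suc n) \<omega>) (Suc n) \<omega>"]) simp
  then show ?thesis
    unfolding step_def by simp
qed

lemma measurable_skeleton_path: "skeleton_path C X \<in> measurable (Pr c) path_space"
proof (rule measurable_PiM_single')
  fix n
  have "(\<lambda>\<omega>. snd (step C X (Suc n) \<omega>)) \<in> borel_measurable (Pr c)"
    by (rule measurable_compose[OF measurable_step])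
      (simp add: borel_measurable_continuous_onI continuous_on_snd)
  then show "(\<lambda>\<omega>. skeleton_path C X \<omega> n) \<in> measurable (Pr c) (count_space UNIV \<Otimes>\<^sub>M borel)"
    unfolding skeleton_path_def by measurable
qed (simp add: space_pair_measure)

lemma prob_chain_path:
  "measure (Pr c) {\<omega>\<in>space (Pr c). \<forall>k\<le>n. C k \<omega> = x k} =
    (if x 0 = c then \<Prod>i<n. pmf (K (x i)) (x (Suc i)) else 0)"
proof (induction n)
  case 0
  interpret prob_space "Pr c"
    by (rule prob)
  have start: "AE \<omega> in Pr c. C 0 \<omega> = c"
    using chain[of c] by (simp add: markov_chain_def)
  have "prob {\<omega>\<in>space (Pr c). C 0 \<omega> = x 0} = prob {\<omega>\<in>space (Pr c). c = x 0}"
    using start by (intro measure_eq_AE) (auto elim: eventually_mono)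
  then show ?case
    by (auto simp: prob_space)
next
  case (Suc n)
  interpret prob_space "Pr c"
    by (rule prob)
  define p where "p k = prob {\<omega>\<in>space (Pr c). \<forall>i\<le>k. C i \<omega> = x i}" for k
  have eq: "p (Suc n) = prob {\<omega>\<in>space (Pr c). C (Suc n) \<omega> = x (Suc n) \<and> (\<forall>k\<le>n. C k \<omega> = x k)}"
    unfolding p_def by (rule arg_cong[where f=prob]) (auto simp: le_Suc_eq)
  have "p (Suc n) = p n * pmf (K (x n)) (x (Suc n))"
  \<comment> \<open>The conditional probability is prescribed only for prefixes of positive
    probability; below a null prefix both sides are 0.\<close>
  proof (cases "p n = 0")
    case True
    have "p (Suc n) \<le> p n"
      unfolding p_def by (intro finite_measure_mono) auto
    moreover have "0 \<le> p (Suc n)"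
      by (simp add: p_def)
    ultimately show ?thesis
      using True by simp
  next
    case False
    then have "0 < p n"
      by (simp add: p_def zero_less_measure_iff)
    then have "p (Suc n) / p n = pmf (K (x n)) (x (Suc n))"
      unfolding eq using chain[of c] unfolding markov_chain_def cond_prob_def p_def by blast
    then show ?thesis
      using False by (simp add: field_simps)
  qed
  then show ?case
    using Suc by (simp add: p_def)
qed

lemma prob_displacement:
  assumes "1 \<le> n" "B \<in> sets borel"
  shows "measure (Pr c) {\<omega>\<in>space (Pr c). snd (X a b n \<omega>) \<in> B} = measure (distr (m a b) borel snd) B"
proof -
  have [measurable]: "X a b n \<in> borel_measurable (Pr c)" "B \<in> sets borel"
    using assms by (simp_all add: measurable_array)
  have snd: "snd \<in> borel_measurable (borel :: (real \<times> 'a) measure)"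
    by (simp add: borel_measurable_continuous_onI continuous_on_snd)
  have "distr (m a b) borel snd = distr (Pr c) borel (\<lambda>\<omega>. snd (X a b n \<omega>))"
    unfolding law[OF assms(1), of c, symmetric] by (subst distr_distr[OF snd]) (simp_all add: comp_def)
  moreover have "(\<lambda>\<omega>. snd (X a b n \<omega>)) \<in> borel_measurable (Pr c)"
    by (rule measurable_compose[OF _ snd]) simp
  ultimately show ?thesis
    by (simp add: measure_distr vimage_def Int_def conj_commute)
qed

lemma prob_displacements:
  assumes B: "\<And>i. B i \<in> sets borel"
  shows "measure (Pr c) {\<omega>\<in>space (Pr c). \<forall>i<n. snd (X (x i) (x (Suc i)) (Suc i) \<omega>) \<in> B i} =
    (\<Prod>i<n. measure (distr (m (x i) (x (Suc i))) borel snd) (B i))"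
proof (cases "n = 0")
  case True
  then show ?thesis
    using prob_space.prob_space[OF prob] by simp
next
  case False
  interpret prob_space "Pr c"
    by (rule prob)
  \<comment> \<open>Transitions may repeat along \<open>x\<close>, but the third component makes the
    array indices distinct, so independence applies. Recovering \<open>i\<close> from
    \<open>Suc i\<close> explains the \<open>k - 1\<close> in \<open>?A\<close>.\<close>
  let ?f = "\<lambda>i. (x i, x (Suc i), Suc i)"
  let ?V = "\<lambda>(a, b, k). X a b k"
  let ?A = "\<lambda>(a :: 's, b :: 's, k). {p :: real \<times> 'a. snd p \<in> B (k - 1)}"
  have A: "?A i \<in> sets borel" for i
  proof -
    have "snd \<in> borel_measurable (borel :: (real \<times> 'a) measure)"
      by (simp add: borel_measurable_continuous_onI continuous_on_snd)
    from measurable_sets[OF this B[of "snd (snd i) - 1"]] show ?thesis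
      by (simp add: vimage_def split_beta)
  qed
  have inj: "inj_on ?f {..<n}"
    by (simp add: inj_on_def)
  have "{\<omega>\<in>space (Pr c). \<forall>i<n. snd (X (x i) (x (Suc i)) (Suc i) \<omega>) \<in> B i} =
      (\<Inter>i\<in>?f ` {..<n}. ?V i -` ?A i \<inter> space (Pr c))"
    using False by auto
  also have "prob \<dots> = (\<Prod>i\<in>?f ` {..<n}. prob (?V i -` ?A i \<inter> space (Pr c)))"
    using False A by (intro indep_varsD[OF array_indep]) auto
  also have "\<dots> = (\<Prod>i<n. prob (X (x i) (x (Suc i)) (Suc i) -` {p. snd p \<in> B i} \<inter> space (Pr c)))"
    by (subst prod.reindex[OF inj]) simp
  also have "\<dots> = (\<Prod>i<n. measure (distr (m (x i) (x (Suc i))) borel snd) (B i))"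
  proof (rule prod.cong)
    fix i
    show "prob (X (x i) (x (Suc i)) (Suc i) -` {p. snd p \<in> B i} \<inter> space (Pr c)) =
        measure (distr (m (x i) (x (Suc i))) borel snd) (B i)"
      using prob_displacement[of "Suc i" "B i" c "x i" "x (Suc i)"] B
      by (simp add: vimage_def Int_def conj_commute)
  qed simp
  finally show ?thesis .
qed

text \<open>Once the states are prescribed, the displacements sit at deterministic array indices,
  and independence of chain and array factors the probability.\<close>

lemma prob_chain_displacements:
  assumes B: "\<And>i. B i \<in> sets borel"
  shows "measure (Pr c) {\<omega>\<in>space (Pr c). (\<forall>k\<le>n. C k \<omega> = x k) \<and>
      (\<forall>i<n. snd (X (x i) (x (Suc i)) (Suc i) \<omega>) \<in> B i)} =
    (if x 0 = c then \<Prod>i<n. pmf (K (x i)) (x (Suc i)) *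
      measure (distr (m (x i) (x (Suc i))) borel snd) (B i) else 0)"
proof -
  interpret prob_space "Pr c"
    by (rule prob)
  let ?I = "UNIV \<times> UNIV \<times> {1..} :: ('s \<times> 's \<times> nat) set"
  let ?E = "{\<omega>\<in>space (Pr c). \<forall>k\<le>n. C k \<omega> = x k}"
  let ?F = "{\<omega>\<in>space (Pr c). \<forall>i<n. snd (X (x i) (x (Suc i)) (Suc i) \<omega>) \<in> B i}"
  have "?E \<in> sets (vimage_algebra (space (Pr c)) (\<lambda>\<omega> n. C n \<omega>) (\<Pi>\<^sub>M n\<in>UNIV. count_space UNIV))"
  proof -
    have "Measurable.pred (\<Pi>\<^sub>M n\<in>UNIV. count_space UNIV) (\<lambda>y :: nat \<Rightarrow> 's. \<forall>k\<le>n. y k = x k)"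
      by measurable
    then have "{y. \<forall>k\<le>n. y k = x k} \<in> sets (\<Pi>\<^sub>M n\<in>UNIV. count_space UNIV :: 's measure)"
      by (simp add: pred_def space_PiM)
    moreover have "?E = (\<lambda>\<omega> n. C n \<omega>) -` {y. \<forall>k\<le>n. y k = x k} \<inter> space (Pr c)"
      by blast
    ultimately show ?thesis
      by (simp only: in_vimage_algebra)
  qed
  moreover have "?F \<in> sets (vimage_algebra (space (Pr c)) (\<lambda>\<omega>. \<lambda>(a, b, n)\<in>?I. X a b n \<omega>) (\<Pi>\<^sub>M i\<in>?I. borel))"
  proof -
    have snd: "snd \<in> borel_measurable (borel :: (real \<times> 'a) measure)"
      by (simp add: borel_measurable_continuous_onI continuous_on_snd)
    have [measurable]: "B i \<in> sets borel" for i
      by (rule B)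
    have [measurable]: "(\<lambda>y. snd (y (x i, x (Suc i), Suc i))) \<in>
        borel_measurable (\<Pi>\<^sub>M i\<in>?I. (borel :: (real \<times> 'a) measure))" for i
      by (rule measurable_compose[OF _ snd], rule measurable_component_singleton) simp
    have "Measurable.pred (\<Pi>\<^sub>M i\<in>?I. (borel :: (real \<times> 'a) measure))
        (\<lambda>y. \<forall>i<n. snd (y (x i, x (Suc i), Suc i)) \<in> B i)"
      by measurable
    then have "{y\<in>space (\<Pi>\<^sub>M i\<in>?I. (borel :: (real \<times> 'a) measure)). \<forall>i<n. snd (y (x i, x (Suc i), Suc i)) \<in> B i} \<in>
        sets (\<Pi>\<^sub>M i\<in>?I. (borel :: (real \<times> 'a) measure))"
      by (simp only: pred_def)
    moreover have "?F = (\<lambda>\<omega>. \<lambda>(a, b, n)\<in>?I. X a b n \<omega>) -`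
        {y\<in>space (\<Pi>\<^sub>M i\<in>?I. (borel :: (real \<times> 'a) measure)). \<forall>i<n. snd (y (x i, x (Suc i), Suc i)) \<in> B i} \<inter>
        space (Pr c)"
      by (auto simp: space_PiM)
    ultimately show ?thesis
      by (simp only: in_vimage_algebra)
  qed
  ultimately have "prob (?E \<inter> ?F) = prob ?E * prob ?F"
    by (rule indep_setD[OF chain_array_indep])
  moreover have "?E \<inter> ?F = {\<omega>\<in>space (Pr c). (\<forall>k\<le>n. C k \<omega> = x k) \<and>
      (\<forall>i<n. snd (X (x i) (x (Suc i)) (Suc i) \<omega>) \<in> B i)}"
    by blast
  ultimately show ?thesis
    by (simp add: prob_chain_path prob_displacements[of B, OF B] prod.distrib)
qed

abbreviation path_law :: "'s \<Rightarrow> (nat \<Rightarrow> 's \<times> 'a) measure" where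
  "path_law c \<equiv> distr (Pr c) path_space (skeleton_path C X)"

lemma markov_additive_path_law:
  "markov_additive K (\<lambda>a b. distr (m a b) borel snd) path_law"
proof (rule markov_additive.intro)
  show "prob_space (path_law c)" for c
    by (rule prob_space.prob_space_distr[OF prob measurable_skeleton_path])
  have "prob_space (m a b)" for a b
    using prob_space.prob_space_distr[OF prob measurable_array[of 1 a b "undefined"]]
    by (simp add: law)
  moreover have "sets (m a b) = sets borel" for a b
    using arg_cong[OF law[of 1 "undefined" a b], of sets] by simp
  then have "snd \<in> borel_measurable (m a b)" for a b
    by (simp add: borel_measurable_continuous_onI continuous_on_snd cong: measurable_cong_sets)
  ultimately show "prob_space (distr (m a b) borel snd)" for a b
    by (rule prob_space.prob_space_distr)
  fix B :: "nat \<Rightarrow> 'a set" and n x c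
  assume B: "\<And>i. B i \<in> sets borel"
  have "measure (path_law c) (path_cylinder n x B) =
      measure (Pr c) (skeleton_path C X -` path_cylinder n x B \<inter> space (Pr c))"
    by (rule measure_distr[OF measurable_skeleton_path path_cylinder_sets[OF B]])
  also have "skeleton_path C X -` path_cylinder n x B \<inter> space (Pr c) =
      {\<omega>\<in>space (Pr c). (\<forall>k\<le>n. C k \<omega> = x k) \<and> (\<forall>i<n. snd (X (x i) (x (Suc i)) (Suc i) \<omega>) \<in> B i)}"
    by (auto simp: path_cylinder_def skeleton_path_def step_def)
  finally show "measure (path_law c) (path_cylinder n x B) =
      (if x 0 = c then \<Prod>i<n. pmf (K (x i)) (x (Suc i)) *
        measure (distr (m (x i) (x (Suc i))) borel snd) (B i) else 0)"
    by (simp add: prob_chain_displacements[of B, OF B])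
qed simp_all

sublocale paths: markov_additive K "\<lambda>a b. distr (m a b) borel snd" path_law
  by (rule markov_additive_path_law)

text \<open>The exceptional sets of all triples \<open>(a, b, n)\<close> form a countable family, so
  one null set serves the random indices used by \<open>step\<close>.\<close>

lemma AE_regular_sample: "AE \<omega> in Pr c. regular_sample C X \<omega>"
proof -
  have m_law: "m a b = distr (Pr c) borel (X a b (Suc n))" for a b n
    by (rule law[symmetric]) simp
  have nonneg: "AE \<omega> in Pr c. 0 \<le> fst (X a b (Suc n) \<omega>)" for a b n
    using duration_nonneg[of a b] unfolding m_law[of a b n]
    by (rule AE_distrD[OF measurable_array, rotated]) simp
  have zero: "AE \<omega> in Pr c. 0 < pmf (K a) b \<longrightarrow> fst (X a b (Suc n) \<omega>) = 0 \<longrightarrow> snd (X a b (Suc n) \<omega>) = 0" for a b n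
  proof (cases "0 < pmf (K a) b")
    case True
    have "{0} \<times> (UNIV - {0}) \<in> sets (borel :: (real \<times> 'a) measure)"
      unfolding borel_prod[symmetric] by (intro pair_measureI) auto
    moreover have "sets (m a b) = sets borel"
      unfolding m_law[of a b n] by simp
    ultimately have "{0} \<times> (UNIV - {0}) \<in> null_sets (m a b)"
      using no_jump[OF True] by (simp add: null_sets_def)
    from AE_not_in[OF this] have "AE \<omega> in Pr c. X a b (Suc n) \<omega> \<notin> {0} \<times> (UNIV - {0})"
      unfolding m_law[of a b n] by (rule AE_distrD[OF measurable_array, rotated]) simp
    then show ?thesis
      by (rule eventually_mono) (auto simp: mem_Times_iff)
  qed simp
  have "AE \<omega> in Pr c. \<forall>n. 0 < pmf (K (C n \<omega>)) (C (Suc n) \<omega>)"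
    using AE_distrD[OF measurable_skeleton_path paths.AE_transitions] by (simp add: skeleton_path_def)
  moreover have "AE \<omega> in Pr c. \<forall>n a b. 0 \<le> fst (X a b (Suc n) \<omega>) \<and>
      (0 < pmf (K a) b \<longrightarrow> fst (X a b (Suc n) \<omega>) = 0 \<longrightarrow> snd (X a b (Suc n) \<omega>) = 0)"
    using nonneg zero by (simp add: AE_all_countable)
  ultimately show ?thesis
    using count_finite[of c]
    by eventually_elim (auto simp: regular_sample_def step_def)
qed

end

text \<open>Needed for the event of the interpolated walk, which is only compared almost surely with
  a measurable event.\<close>

lemma completion_measure_AE_eq:
  assumes S: "S \<in> sets M" and E: "E \<subseteq> space M" and AE: "AE x in M. x \<in> E \<longleftrightarrow> x \<in> S"
  shows "E \<in> sets (completion M)" "measure (completion M) E = measure M S"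
proof -
  obtain N where N: "{x\<in>space M. \<not> (x \<in> E \<longleftrightarrow> x \<in> S)} \<subseteq> N" "N \<in> null_sets M"
    using AE unfolding eventually_ae_filter by blast
  have "E = (S - N) \<union> (E \<inter> N)"
    using N(1) E sets.sets_into_space[OF S] by blast
  moreover have "S - N \<in> sets M"
    using S N(2) by (intro sets.Diff) auto
  ultimately show E': "E \<in> sets (completion M)"
    using N(2) by (intro sets_completionI[of E "S - N" "E \<inter> N" N M]) auto
  have "measure (completion M) E = measure (completion M) S"
    using E' S AE_completion[OF AE] by (intro measure_eq_AE) auto
  then show "measure (completion M) E = measure M S"
    using S by simp
qed

context markov_levy_walk
begin

lemma prob_hits_io_skeleton_path:
  assumes "G \<in> sets borel"
  shows "{\<omega>\<in>space (Pr c). skeleton_path C X \<omega> \<in> hits_io G 0} \<in> sets (Pr c)"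
    and "measure (Pr c) {\<omega>\<in>space (Pr c). skeleton_path C X \<omega> \<in> hits_io G 0} = measure (path_law c) (hits_io G 0)"
proof -
  have eq: "{\<omega>\<in>space (Pr c). skeleton_path C X \<omega> \<in> hits_io G 0} =
      skeleton_path C X -` hits_io G 0 \<inter> space (Pr c)"
    by blast
  show "{\<omega>\<in>space (Pr c). skeleton_path C X \<omega> \<in> hits_io G 0} \<in> sets (Pr c)"
    unfolding eq by (rule measurable_sets[OF measurable_skeleton_path hits_io_sets[OF assms]])
  show "measure (Pr c) {\<omega>\<in>space (Pr c). skeleton_path C X \<omega> \<in> hits_io G 0} = measure (path_law c) (hits_io G 0)"
    unfolding eq by (rule measure_distr[OF measurable_skeleton_path hits_io_sets[OF assms], symmetric])
qed

end

section \<open>Zero-one laws and dichotomy for both walks\<close>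

locale recurrent_markov_levy_walk = markov_levy_walk K m Pr C X
  for K :: "'s::countable \<Rightarrow> 's pmf" and m :: "'s \<Rightarrow> 's \<Rightarrow> (real \<times> 'a::euclidean_space) measure"
    and Pr :: "'s \<Rightarrow> 'w measure" and C X +
  assumes irreducible: "irreducible_kernel K"
    and recurrent: "recurrent_chain Pr C"
begin

lemma zero_one_skeleton_path:
  assumes "G \<in> sets borel"
  shows "measure (path_law c) (hits_io G 0) \<in> {0, 1}"
proof (rule paths.zero_one_hits_io[OF assms])
  have pred: "Measurable.pred path_space (\<lambda>w :: nat \<Rightarrow> 's \<times> 'a. \<exists>j\<ge>1. fst (w j) = c)"
    by measurable
  have "AE \<omega> in Pr c. \<exists>j\<ge>1. C j \<omega> = c"
    using recurrent by (simp add: recurrent_chain_def)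
  then have "AE \<omega> in Pr c. \<exists>j\<ge>1. fst (skeleton_path C X \<omega> j) = c"
    by (simp add: skeleton_path_def)
  then show "AE w in path_law c. \<exists>j\<ge>1. fst (w j) = c"
    using pred by (subst AE_distr_iff[OF measurable_skeleton_path]) (simp_all add: pred_def)
qed

lemma MRW_zero_one:
  assumes A: "A \<in> sets borel"
  shows "{\<omega>\<in>space (Pr c). \<forall>n. \<exists>k\<ge>n. MRW C X k \<omega> \<in> A} \<in> sets (Pr c)"
    and "measure (Pr c) {\<omega>\<in>space (Pr c). \<forall>n. \<exists>k\<ge>n. MRW C X k \<omega> \<in> A} \<in> {0, 1}"
proof -
  have G: "A \<times> UNIV \<in> sets (borel :: ('a \<times> 'a) measure)"
    unfolding borel_prod[symmetric] using A by (intro pair_measureI) auto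
  have eq: "{\<omega>\<in>space (Pr c). \<forall>n. \<exists>k\<ge>n. MRW C X k \<omega> \<in> A} =
      {\<omega>\<in>space (Pr c). skeleton_path C X \<omega> \<in> hits_io (A \<times> UNIV) 0}"
    by (simp add: hits_io_def walk_skeleton_path)
  show "{\<omega>\<in>space (Pr c). \<forall>n. \<exists>k\<ge>n. MRW C X k \<omega> \<in> A} \<in> sets (Pr c)"
    unfolding eq by (rule prob_hits_io_skeleton_path(1)[OF G])
  show "measure (Pr c) {\<omega>\<in>space (Pr c). \<forall>n. \<exists>k\<ge>n. MRW C X k \<omega> \<in> A} \<in> {0, 1}"
    unfolding eq prob_hits_io_skeleton_path(2)[OF G] by (rule zero_one_skeleton_path[OF G])
qed

lemma MLW_zero_one:
  assumes A: "A \<in> sets borel"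
  shows "{\<omega>\<in>space (Pr c). \<forall>t\<ge>0. \<exists>u\<ge>t. MLW C X u \<omega> \<in> A} \<in> sets (completion (Pr c))"
    and "measure (completion (Pr c)) {\<omega>\<in>space (Pr c). \<forall>t\<ge>0. \<exists>u\<ge>t. MLW C X u \<omega> \<in> A} \<in> {0, 1}"
proof -
  define f where "f n \<omega> = (walk n (skeleton_path C X \<omega>), snd (skeleton_path C X \<omega> n))" for n \<omega>
  have f: "f n \<in> borel_measurable (Pr c)" for n
  proof -
    have "(\<lambda>w :: nat \<Rightarrow> 's \<times> 'a. (walk n w, snd (w n))) \<in> measurable path_space (borel \<Otimes>\<^sub>M borel)"
      by measurable
    from measurable_compose[OF measurable_skeleton_path this] show ?thesis
      unfolding f_def borel_prod .
  qed
  have "finite_measure (distr (Pr c) borel (f n))" for n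
    using prob_space.prob_space_distr[OF prob f[of n]] by (simp add: prob_space_def)
  \<comment> \<open>Applied to the laws of the segments \<open>f n\<close> for all \<open>n\<close>
    together, so that a single Borel set \<open>G\<close> replaces the segments meeting
    \<open>A\<close>.\<close>
  from segment_hits_null_sandwich[of "\<lambda>n. distr (Pr c) borel (f n)", OF this _ A]
  obtain G where G: "G \<in> sets borel" and AE_G: "\<And>n. AE p in distr (Pr c) borel (f n).
      p \<in> G \<longleftrightarrow> (\<exists>s\<in>{0..1}. fst p + s *\<^sub>R snd p \<in> A)"
    by auto
  have "AE \<omega> in Pr c. \<forall>n. f n \<omega> \<in> G \<longleftrightarrow>
      (\<exists>s\<in>{0..1}. MRW C X n \<omega> + s *\<^sub>R snd (step C X (Suc n) \<omega>) \<in> A)"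
    unfolding AE_all_countable
  proof
    fix n
    show "AE \<omega> in Pr c. f n \<omega> \<in> G \<longleftrightarrow>
      (\<exists>s\<in>{0..1}. MRW C X n \<omega> + s *\<^sub>R snd (step C X (Suc n) \<omega>) \<in> A)"
      using AE_distrD[OF f AE_G[of n]] by (simp add: f_def walk_skeleton_path) (simp add: skeleton_path_def)
  qed
  with AE_regular_sample[of c] have AE_eq: "AE \<omega> in Pr c.
      \<omega> \<in> {\<omega>\<in>space (Pr c). \<forall>t\<ge>0. \<exists>u\<ge>t. MLW C X u \<omega> \<in> A} \<longleftrightarrow>
      \<omega> \<in> {\<omega>\<in>space (Pr c). skeleton_path C X \<omega> \<in> hits_io G 0}"
  proof eventually_elim
    case (elim \<omega>)
    have "(\<forall>t\<ge>0. \<exists>u\<ge>t. MLW C X u \<omega> \<in> A) \<longleftrightarrow> (\<forall>k. \<exists>n\<ge>k. f n \<omega> \<in> G)"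
      unfolding regular_sample.MLW_io_iff[OF elim(1)] using elim(2) by simp
    then show ?case
      by (simp add: hits_io_def f_def)
  qed
  note completion = completion_measure_AE_eq[OF prob_hits_io_skeleton_path(1)[OF G] _ AE_eq]
  show "{\<omega>\<in>space (Pr c). \<forall>t\<ge>0. \<exists>u\<ge>t. MLW C X u \<omega> \<in> A} \<in> sets (completion (Pr c))"
    by (rule completion(1)) blast
  have "measure (completion (Pr c)) {\<omega>\<in>space (Pr c). \<forall>t\<ge>0. \<exists>u\<ge>t. MLW C X u \<omega> \<in> A} =
      measure (path_law c) (hits_io G 0)"
    by (subst completion(2)) (blast, rule prob_hits_io_skeleton_path(2)[OF G])
  then show "measure (completion (Pr c)) {\<omega>\<in>space (Pr c). \<forall>t\<ge>0. \<exists>u\<ge>t. MLW C X u \<omega> \<in> A} \<in> {0, 1}"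
    using zero_one_skeleton_path[OF G] by simp
qed

text \<open>If from some state no integer radius is undercut infinitely often, the same holds from
  every state. Otherwise each state has a radius undercut with positive probability, hence with
  probability 1.\<close>

lemma transient_recurrent_dichotomy:
  fixes Y :: "'t::linorder \<Rightarrow> 'w \<Rightarrow> 'a" and G :: "nat \<Rightarrow> ('a \<times> 'a) set"
  assumes G: "\<And>r. G r \<in> sets borel"
    and shift: "\<And>z r. \<exists>r'. \<forall>x v. (x, v) \<in> G r \<longrightarrow> (z + x, v) \<in> G r'"
    and Y: "\<And>c. AE \<omega> in Pr c. \<forall>r. (\<exists>\<^sub>F t in at_top. norm (Y t \<omega>) < real r) \<longleftrightarrow>
      skeleton_path C X \<omega> \<in> hits_io (G r) 0"
  shows "(transient_walk Pr Y \<or> recurrent_walk Pr Y) \<and> \<not> (transient_walk Pr Y \<and> recurrent_walk Pr Y)"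
proof
  show "transient_walk Pr Y \<or> recurrent_walk Pr Y"
  proof (cases "\<exists>c. AE w in path_law c. \<forall>r. w \<notin> hits_io (G r) 0")
    case True
    then have never: "AE w in path_law b. \<forall>r. w \<notin> hits_io (G r) 0" for b
      using paths.AE_never_hits_io_transfer[OF irreducible G shift] by blast
    have "AE \<omega> in Pr b. filterlim (\<lambda>t. norm (Y t \<omega>)) at_top at_top" for b
      using AE_distrD[OF measurable_skeleton_path never[of b]] Y[of b]
    proof eventually_elim
      case (elim \<omega>)
      have "\<forall>\<^sub>F t in at_top. Z \<le> norm (Y t \<omega>)" for Z
      proof -
        obtain r :: nat where r: "Z \<le> real r"
          using real_arch_simple by blast
        have "\<forall>\<^sub>F t in at_top. \<not> norm (Y t \<omega>) < real r"
          using elim by (simp add: frequently_def)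
        then show ?thesis
          by (rule eventually_mono) (use r in linarith)
      qed
      then show ?case
        by (simp add: filterlim_at_top)
    qed
    then show ?thesis
      by (simp add: transient_walk_def)
  next
    case False
    have "\<exists>r>0. AE \<omega> in Pr c. Liminf at_top (\<lambda>t. ereal (norm (Y t \<omega>))) < ereal r" for c
    proof -
      interpret L: prob_space "path_law c"
        by (rule paths.prob_L)
      obtain r where r: "\<not> (AE w in path_law c. w \<notin> hits_io (G r) 0)"
        using False unfolding AE_all_countable by blast
      have meas: "hits_io (G r) 0 \<in> sets (path_law c)"
        using hits_io_sets[OF G] by simp
      then have "L.prob (hits_io (G r) 0) \<noteq> 0"
        using r by (simp add: L.prob_eq_0)
      then have "L.prob (hits_io (G r) 0) = 1"
        using zero_one_skeleton_path[OF G, of c r] by simp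
      then have "AE w in path_law c. w \<in> hits_io (G r) 0"
        using L.AE_in_set_eq_1[OF meas] by simp
      \<comment> \<open>Values frequently below \<open>r\<close> give only a lower limit at most
        \<open>r\<close>; the added 1 makes the inequality strict.\<close>
      from AE_distrD[OF measurable_skeleton_path this] Y[of c]
      have "AE \<omega> in Pr c. Liminf at_top (\<lambda>t. ereal (norm (Y t \<omega>))) < ereal (real r + 1)"
      proof eventually_elim
        case (elim \<omega>)
        then have freq: "\<exists>\<^sub>F t in at_top. norm (Y t \<omega>) < real r"
          by blast
        have "\<not> ereal (real r) < Liminf at_top (\<lambda>t. ereal (norm (Y t \<omega>)))"
        proof
          assume "ereal (real r) < Liminf at_top (\<lambda>t. ereal (norm (Y t \<omega>)))"
          from less_LiminfD[OF this] have "\<forall>\<^sub>F t in at_top. \<not> norm (Y t \<omega>) < real r"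
            by (rule eventually_mono) simp
          with freq show False
            by (simp add: frequently_def)
        qed
        then have "Liminf at_top (\<lambda>t. ereal (norm (Y t \<omega>))) \<le> ereal (real r)"
          by (rule leI)
        also have "\<dots> < ereal (real r + 1)"
          by simp
        finally show ?case .
      qed
      then show ?thesis
        by (intro exI[of _ "real r + 1"]) simp
    qed
    then show ?thesis
      by (simp add: recurrent_walk_def)
  qed
next
  show "\<not> (transient_walk Pr Y \<and> recurrent_walk Pr Y)"
  proof
    assume "transient_walk Pr Y \<and> recurrent_walk Pr Y"
    \<comment> \<open>Any one starting state refutes both alternatives together;
      \<open>undefined\<close> names one.\<close>
    then obtain r where trans: "AE \<omega> in Pr undefined. filterlim (\<lambda>t. norm (Y t \<omega>)) at_top at_top"
      and rec: "AE \<omega> in Pr undefined. Liminf at_top (\<lambda>t. ereal (norm (Y t \<omega>))) < ereal r"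
      unfolding transient_walk_def recurrent_walk_def by blast
    have "AE \<omega> in Pr undefined. False"
      using trans rec
    proof eventually_elim
      case (elim \<omega>)
      have "\<forall>\<^sub>F t in at_top. r \<le> norm (Y t \<omega>)"
        using elim(1) by (simp add: filterlim_at_top)
      then have "ereal r \<le> Liminf at_top (\<lambda>t. ereal (norm (Y t \<omega>)))"
        by (intro Liminf_bounded) simp
      with elim(2) show ?case
        by simp
    qed
    then show False
      by (simp add: prob_space.AE_False[OF prob])
  qed
qed

lemma MRW_dichotomy:
  "(transient_walk Pr (MRW C X) \<or> recurrent_walk Pr (MRW C X)) \<and>
    \<not> (transient_walk Pr (MRW C X) \<and> recurrent_walk Pr (MRW C X))"
proof (rule transient_recurrent_dichotomy)
  show "ball 0 (real r) \<times> UNIV \<in> sets (borel :: ('a \<times> 'a) measure)" for r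
    by (intro borel_open open_Times) auto
  fix z :: 'a and r :: nat
  show "\<exists>r'. \<forall>x v. (x, v) \<in> ball 0 (real r) \<times> (UNIV :: 'a set) \<longrightarrow> (z + x, v) \<in> ball 0 (real r') \<times> UNIV"
  proof -
    obtain r' :: nat where r': "norm z + real r \<le> real r'"
      using real_arch_simple by blast
    have "norm (z + x) < real r'" if "norm x < real r" for x
      using norm_triangle_ineq[of z x] r' that by linarith
    then show ?thesis
      by (intro exI[of _ r']) simp
  qed
next
  show "AE \<omega> in Pr c. \<forall>r. (\<exists>\<^sub>F t in at_top. norm (MRW C X t \<omega>) < real r) \<longleftrightarrow>
      skeleton_path C X \<omega> \<in> hits_io (ball 0 (real r) \<times> UNIV) 0" for c
    by (simp add: frequently_sequentially hits_io_def walk_skeleton_path)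
qed

lemma MLW_dichotomy:
  "(transient_walk Pr (MLW C X) \<or> recurrent_walk Pr (MLW C X)) \<and>
    \<not> (transient_walk Pr (MLW C X) \<and> recurrent_walk Pr (MLW C X))"
proof -
  \<comment> \<open>For an open ball this is a union of open preimages over \<open>s\<close>, hence
    open and Borel.\<close>
  define G where "G r = {p :: 'a \<times> 'a. \<exists>s\<in>{0..1}. fst p + s *\<^sub>R snd p \<in> ball 0 (real r)}" for r :: nat
  show ?thesis
  proof (rule transient_recurrent_dichotomy)
    show "G r \<in> sets borel" for r
    proof -
      have "G r = (\<Union>s\<in>{0..1}. (\<lambda>p. fst p + s *\<^sub>R snd p) -` ball 0 (real r))"
        by (auto simp: G_def)
      also have "open \<dots>"
        by (intro open_UN ballI open_vimage open_ball continuous_intros)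
      finally show ?thesis
        by (rule borel_open)
    qed
    fix z :: 'a and r :: nat
    show "\<exists>r'. \<forall>x v. (x, v) \<in> G r \<longrightarrow> (z + x, v) \<in> G r'"
    proof -
      obtain r' :: nat where r': "norm z + real r \<le> real r'"
        using real_arch_simple by blast
      have "norm (z + x + y) < real r'" if "norm (x + y) < real r" for x y
        using norm_triangle_ineq[of z "x + y"] r' that by (simp add: add.assoc)
      then show ?thesis
        unfolding G_def by (intro exI[of _ r']) auto
    qed
  next
    show "AE \<omega> in Pr c. \<forall>r. (\<exists>\<^sub>F t in at_top. norm (MLW C X t \<omega>) < real r) \<longleftrightarrow>
        skeleton_path C X \<omega> \<in> hits_io (G r) 0" for c
      using AE_regular_sample
    proof (rule eventually_mono, intro allI)
      fix \<omega> r assume "regular_sample C X \<omega>"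
      note io = regular_sample.MLW_io_iff[OF this, of "ball 0 (real r)"]
      have "(\<exists>\<^sub>F t in at_top. norm (MLW C X t \<omega>) < real r) \<longleftrightarrow>
          (\<forall>t\<ge>0. \<exists>u\<ge>t. MLW C X u \<omega> \<in> ball 0 (real r))"
      proof
        assume "\<exists>\<^sub>F t in at_top. norm (MLW C X t \<omega>) < real r"
        then show "\<forall>t\<ge>0. \<exists>u\<ge>t. MLW C X u \<omega> \<in> ball 0 (real r)"
          unfolding frequently_def eventually_at_top_linorder by auto
      next
        assume io': "\<forall>t\<ge>0. \<exists>u\<ge>t. MLW C X u \<omega> \<in> ball 0 (real r)"
        show "\<exists>\<^sub>F t in at_top. norm (MLW C X t \<omega>) < real r"
          unfolding frequently_def eventually_at_top_linorder
        proof
          assume "\<exists>N. \<forall>n\<ge>N. \<not> norm (MLW C X n \<omega>) < real r"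
          then obtain N where N: "\<And>n. N \<le> n \<Longrightarrow> \<not> norm (MLW C X n \<omega>) < real r"
            by blast
          \<comment> \<open>The filter ranges over all reals while the event quantifies over
            \<open>t \<ge> 0\<close>; the maximum reconciles the two.\<close>
          obtain u where "max 0 N \<le> u" "MLW C X u \<omega> \<in> ball 0 (real r)"
            using io' by (meson max.cobounded1)
          with N[of u] show False
            by simp
        qed
      qed
      also note io
      also have "(\<forall>k. \<exists>n\<ge>k. \<exists>s\<in>{0..1}. MRW C X n \<omega> + s *\<^sub>R snd (step C X (Suc n) \<omega>) \<in> ball 0 (real r)) \<longleftrightarrow>
          skeleton_path C X \<omega> \<in> hits_io (G r) 0"
        by (simp add: hits_io_def G_def walk_skeleton_path) (simp add: skeleton_path_def)
      finally show "(\<exists>\<^sub>F t in at_top. norm (MLW C X t \<omega>) < real r) \<longleftrightarrow>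
          skeleton_path C X \<omega> \<in> hits_io (G r) 0" .
    qed
  qed
qed

end

theorem proposition2p1:
  fixes K :: "'s::countable \<Rightarrow> 's pmf"
    and m :: "'s \<Rightarrow> 's \<Rightarrow> (real \<times> 'a::euclidean_space) measure"
    and Pr :: "'s \<Rightarrow> 'w measure"
    and C :: "nat \<Rightarrow> 'w \<Rightarrow> 's"
    and X :: "'s \<Rightarrow> 's \<Rightarrow> nat \<Rightarrow> 'w \<Rightarrow> real \<times> 'a"
  assumes "markov_levy_walk K m Pr C X"
    and "irreducible_kernel K"
    and "recurrent_chain Pr C"
  shows "(\<forall>c. \<forall>A\<in>sets (borel :: 'a measure).
            {\<omega> \<in> space (Pr c). \<forall>t\<ge>0. \<exists>u\<ge>t. MLW C X u \<omega> \<in> A} \<in> sets (completion (Pr c)) \<and>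
            measure (completion (Pr c))
              {\<omega> \<in> space (Pr c). \<forall>t\<ge>0. \<exists>u\<ge>t. MLW C X u \<omega> \<in> A} \<in> {0, 1})
       \<and> (\<forall>c. \<forall>A\<in>sets (borel :: 'a measure).
            {\<omega> \<in> space (Pr c). \<forall>n. \<exists>k\<ge>n. MRW C X k \<omega> \<in> A} \<in> sets (Pr c) \<and>
            measure (Pr c) {\<omega> \<in> space (Pr c). \<forall>n. \<exists>k\<ge>n. MRW C X k \<omega> \<in> A} \<in> {0, 1})
       \<and> (transient_walk Pr (MLW C X) \<or> recurrent_walk Pr (MLW C X))
       \<and> \<not> (transient_walk Pr (MLW C X) \<and> recurrent_walk Pr (MLW C X))
       \<and> (transient_walk Pr (MRW C X) \<or> recurrent_walk Pr (MRW C X))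
       \<and> \<not> (transient_walk Pr (MRW C X) \<and> recurrent_walk Pr (MRW C X))"
proof -
  interpret recurrent_markov_levy_walk K m Pr C X
    using assms by (intro recurrent_markov_levy_walk.intro recurrent_markov_levy_walk_axioms.intro)
  show ?thesis
    by (intro conjI allI ballI MLW_zero_one MRW_zero_one MLW_dichotomy[THEN conjunct1]
        MLW_dichotomy[THEN conjunct2] MRW_dichotomy[THEN conjunct1] MRW_dichotomy[THEN conjunct2])
qed

end
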